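(* Let $X_1,\dots,X_n$ be i.i.d. with law $P_0:=P_{\alpha_0}$, where $\{P_\alpha:\alpha\in A\}$ is the null model ($A$ a metric space, $\alpha_0\in A$). Let $\hat\alpha=\hat\alpha(X_1,\dots,X_n)\in A$ be an estimator. Let $\Gamma$ be an index set and for each $\gamma\in\Gamma$, $\alpha\in A$ let $h_\gamma(\cdot,\alpha)\in L_2^0(P_\alpha)$ with $\sup_{x,\gamma}|h_\gamma(x,\alpha)|<\infty$. Define the score process $$Z_n(\gamma,\alpha)=n^{-1/2}\sum_{i=1}^n\big[h_\gamma(X_i,\alpha)-\Pi(h_\gamma(\cdot,\alpha),\alpha)(X_i)\big]$$ and the statistic $$W_n(\gamma)=\sqrt n\,(P_n-P_{\hat\alpha})\big(h_\gamma(\cdot,\hat\alpha)\big),\qquad \gamma\in\Gamma .$$ Assume the following conditions, where $\|\cdot\|_\infty$ denotes the supremum over $\gamma\in\Gamma$ and $o_P$ refers to $P_0$: (M0) $\{h_\gamma(\cdot,\alpha_0)-\Pi(h_\gamma(\cdot,\alpha_0),\alpha_0):\gamma\in\Gamma\}$ is a universal Donsker class; (M3) $\|(P_n-P_0)(h_\gamma(\cdot,\hat\alpha)-h_\gamma(\cdot,\alpha_0))\|_\infty=o_P(n^{-1/2})$; (M4) $\|(P_{\hat\alpha}-P_0)(h_\gamma(\cdot,\hat\alpha)-h_\gamma(\cdot,\alpha_0))\|_\infty=o_P(n^{-1/2})$; (M5) $\|(P_{\hat\alpha}-P_0)h_\gamma(\cdot,\alpha_0)-(P_n-P_0)\Pi(h_\gamma(\cdot,\alpha_0),\alpha_0)\|_\infty=o_P(n^{-1/2})$.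 Then, under $P_0$: (i) $Z_n(\cdot,\alpha_0)\Rightarrow Z(\cdot,\alpha_0)$; (ii) $\sup_{\gamma\in\Gamma}|W_n(\gamma)-Z_n(\gamma,\alpha_0)|=o_{P_0}(1)$; and hence (iii) $W_n(\cdot)\Rightarrow Z(\cdot,\alpha_0)$.
   Context: For a probability $Q$ and function $f$, $Qf=\int f\,dQ$; $P_n$ is the empirical measure of $X_1,\dots,X_n$. $L_2^0(P_\alpha)$ is the space of $P_\alpha$-square-integrable functions with $P_\alpha$-mean zero. $\dot{\mathcal P}_0(\alpha)\subset L_2^0(P_\alpha)$ is the tangent space of the null model $\{P_\alpha:\alpha\in A\}$ at $P_\alpha$, i.e. the closed linear span of the score functions of all regular (quadratic-mean differentiable) one-dimensional submodels of the null model passing through $P_\alpha$; $\Pi(\cdot,\alpha)$ is the orthogonal projection in $L_2(P_\alpha)$ onto $\dot{\mathcal P}_0(\alpha)$. $Z(\cdot,\alpha_0)$ denotes a mean-zero Gaussian process indexed by $\Gamma$ with covariance $\mathrm{cov}(Z(\gamma_1,\alpha_0),Z(\gamma_2,\alpha_0))=\mathrm{cov}_{P_0}(h_1,h_2)-\mathrm{cov}_{P_0}(\Pi(h_1,\alpha_0),\Pi(h_2,\alpha_0))$ where $h_j=h_{\gamma_j}(\cdot,\alpha_0)$. Weak convergence $\Rightarrow$ is weak convergence of $\ell^\infty(\Gamma)$-valued random elements (in the Hoffmann-Jørgensen sense, outer probabilities), $\ell^\infty(\Gamma)$ being the bounded real functions on $\Gamma$ with the sup norm. *)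

theory Defs
  imports "HOL-Probability.Probability"
begin

definition outer_prob :: "'w measure \<Rightarrow> 'w set \<Rightarrow> real" where
  "outer_prob Q S = Inf {measure Q B | B. B \<in> sets Q \<and> S \<inter> space Q \<subseteq> B}"

definition outer_exp :: "'w measure \<Rightarrow> ('w \<Rightarrow> real) \<Rightarrow> real" where
  "outer_exp Q T = Inf {integral\<^sup>L Q U | U. U \<in> borel_measurable Q \<and> integrable Q U
                          \<and> (\<forall>\<omega>\<in>space Q. T \<omega> \<le> U \<omega>)}"

text \<open>\<open>T n\<close> is a nonnegative (extended real) quantity; \<open>T n = o_P(1)\<close> in outer probability.\<close>
definition oP1 :: "'w measure \<Rightarrow> (nat \<Rightarrow> 'w \<Rightarrow> ereal) \<Rightarrow> bool" where
  "oP1 Q T \<longleftrightarrow> (\<forall>e>0. ((\<lambda>n. outer_prob Q {\<omega>\<in>space Q. T n \<omega> > ereal e}) \<longlonglongrightarrow> 0))"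

section \<open>The space \<open>\<ell>^\<infinity>(\<Gamma>)\<close> (here \<open>\<Gamma>\<close> = UNIV of type 'g)\<close>

definition supn :: "('g \<Rightarrow> real) \<Rightarrow> ereal" where
  "supn x = (SUP \<gamma>. ereal \<bar>x \<gamma>\<bar>)"

definition linf :: "('g \<Rightarrow> real) set" where
  "linf = {x. bounded (range x)}"

definition supdist :: "('g \<Rightarrow> real) \<Rightarrow> ('g \<Rightarrow> real) \<Rightarrow> real" where
  "supdist x y = (SUP \<gamma>. \<bar>x \<gamma> - y \<gamma>\<bar>)"

definition linf_open :: "('g \<Rightarrow> real) set \<Rightarrow> bool" where
  "linf_open U \<longleftrightarrow> U \<subseteq> linf \<and>
     (\<forall>x\<in>U. \<exists>e>0. \<forall>y\<in>linf. supdist x y < e \<longrightarrow> y \<in> U)"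

definition linf_borel :: "('g \<Rightarrow> real) measure" where
  "linf_borel = sigma linf {U. linf_open U}"

definition linf_compact :: "('g \<Rightarrow> real) set \<Rightarrow> bool" where
  "linf_compact C \<longleftrightarrow> C \<subseteq> linf \<and>
     (\<forall>s::nat \<Rightarrow> ('g \<Rightarrow> real). (\<forall>n. s n \<in> C) \<longrightarrow>
        (\<exists>(r::nat \<Rightarrow> nat) x. strict_mono r \<and> x \<in> C \<and> ((\<lambda>n. supdist (s (r n)) x) \<longlonglongrightarrow> 0)))"

definition tight_borel_law :: "('g \<Rightarrow> real) measure \<Rightarrow> bool" where
  "tight_borel_law L \<longleftrightarrow> prob_space L \<and> sets L = sets linf_borel \<and>
     (\<forall>e>0. \<exists>Kc. linf_compact Kc \<and> Kc \<in> sets L \<and> measure L Kc \<ge> 1 - e)"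

definition bounded_cont_linf :: "(('g \<Rightarrow> real) \<Rightarrow> real) \<Rightarrow> bool" where
  "bounded_cont_linf f \<longleftrightarrow> (\<exists>B. \<forall>x. \<bar>f x\<bar> \<le> B) \<and>
     (\<forall>x\<in>linf. \<forall>e>0. \<exists>d>0. \<forall>y\<in>linf. supdist x y < d \<longrightarrow> \<bar>f y - f x\<bar> < e)"

definition weak_conv_HJ :: "'w measure \<Rightarrow> (nat \<Rightarrow> 'w \<Rightarrow> 'g \<Rightarrow> real) \<Rightarrow> ('g \<Rightarrow> real) measure \<Rightarrow> bool" where
  "weak_conv_HJ Q X L \<longleftrightarrow> (\<forall>f. bounded_cont_linf f \<longrightarrow>
      ((\<lambda>n. outer_exp Q (\<lambda>\<omega>. f (X n \<omega>))) \<longlonglongrightarrow> integral\<^sup>L L f))"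

definition centered_gaussian_law :: "('g \<Rightarrow> real) measure \<Rightarrow> ('g \<Rightarrow> 'g \<Rightarrow> real) \<Rightarrow> bool" where
  "centered_gaussian_law L Cv \<longleftrightarrow> (\<forall>S c. finite S \<longrightarrow>
     (let v = (\<Sum>i\<in>S. \<Sum>j\<in>S. c i * c j * Cv i j) in
       distr L borel (\<lambda>x. \<Sum>i\<in>S. c i * x i) =
         (if v = 0 then return borel 0
          else density lborel (\<lambda>y. ennreal (normal_density 0 (sqrt v) y)))))"

definition Pn :: "nat \<Rightarrow> (nat \<Rightarrow> 'x) \<Rightarrow> ('x \<Rightarrow> real) \<Rightarrow> real" where
  "Pn n \<omega> f = (\<Sum>i<n. f (\<omega> i)) / real n"

text \<open>i.i.d. sample space: \<open>X_i(\<omega>) = \<omega> (i-1)\<close> under the infinite product measure.\<close>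
definition iid_space :: "'x measure \<Rightarrow> (nat \<Rightarrow> 'x) measure" where
  "iid_space Q = Pi\<^sub>M UNIV (\<lambda>i::nat. Q)"

definition Donsker :: "'x measure \<Rightarrow> ('g \<Rightarrow> 'x \<Rightarrow> real) \<Rightarrow> bool" where
  "Donsker Q f \<longleftrightarrow> (\<forall>\<gamma>. integrable Q (f \<gamma>)) \<and>
     (\<forall>x\<in>space Q. bounded (range (\<lambda>\<gamma>. f \<gamma> x - integral\<^sup>L Q (f \<gamma>)))) \<and>
     (\<exists>L. tight_borel_law L \<and>
        weak_conv_HJ (iid_space Q)
          (\<lambda>n \<omega> \<gamma>. sqrt (real n) * (Pn n \<omega> (f \<gamma>) - integral\<^sup>L Q (f \<gamma>))) L)"

definition universal_Donsker :: "'x measure \<Rightarrow> ('g \<Rightarrow> 'x \<Rightarrow> real) \<Rightarrow> bool" where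
  "universal_Donsker M f \<longleftrightarrow> (\<forall>\<gamma>. f \<gamma> \<in> borel_measurable M) \<and>
     (\<forall>Q. prob_space Q \<and> sets Q = sets M \<longrightarrow> Donsker Q f)"

text \<open>\<open>g\<close> is the score of the QMD one-dimensional submodel \<open>t \<mapsto> P (pth t)\<close>, \<open>t \<in> [0,\<epsilon>)\<close>,
  through \<open>P \<alpha>\<close>: \<open>\<integral>(\<surd>q_t - \<surd>p - t/2 g \<surd>p)^2 d\<mu> = o(t^2)\<close> (independent of the dominating \<open>\<mu>\<close>).\<close>
definition qmd_score :: "('a \<Rightarrow> 'x measure) \<Rightarrow> 'a \<Rightarrow> (real \<Rightarrow> 'a) \<Rightarrow> ('x \<Rightarrow> real) \<Rightarrow> bool" where
  "qmd_score P \<alpha> pth g \<longleftrightarrow> pth 0 = \<alpha> \<and>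
     g \<in> borel_measurable (P \<alpha>) \<and> integrable (P \<alpha>) (\<lambda>x. (g x)\<^sup>2) \<and>
     (\<exists>D. (D \<longlongrightarrow> 0) (at_right 0) \<and>
        (\<forall>\<^sub>F t in at_right 0. \<exists>\<mu> p q. sigma_finite_measure \<mu> \<and>
            p \<in> borel_measurable \<mu> \<and> q \<in> borel_measurable \<mu> \<and>
            (\<forall>x. p x \<ge> 0) \<and> (\<forall>x. q x \<ge> 0) \<and>
            P \<alpha> = density \<mu> (\<lambda>x. ennreal (p x)) \<and>
            P (pth t) = density \<mu> (\<lambda>x. ennreal (q x)) \<and>
            (\<integral>\<^sup>+ x. ennreal ((sqrt (q x) - sqrt (p x) - t / 2 * g x * sqrt (p x))\<^sup>2) \<partial>\<mu>)
               \<le> ennreal (t\<^sup>2 * D t)))"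

definition scores :: "('a \<Rightarrow> 'x measure) \<Rightarrow> 'a \<Rightarrow> ('x \<Rightarrow> real) set" where
  "scores P \<alpha> = {g. \<exists>pth. qmd_score P \<alpha> pth g}"

definition tangent_space :: "('a \<Rightarrow> 'x measure) \<Rightarrow> 'a \<Rightarrow> ('x \<Rightarrow> real) set" where
  "tangent_space P \<alpha> = {f. f \<in> borel_measurable (P \<alpha>) \<and> integrable (P \<alpha>) (\<lambda>x. (f x)\<^sup>2) \<and>
     (\<forall>e>0. \<exists>S c. finite S \<and> S \<subseteq> scores P \<alpha> \<and>
        integral\<^sup>L (P \<alpha>) (\<lambda>x. (f x - (\<Sum>g\<in>S. c g * g x))\<^sup>2) < e)}"

definition is_tangent_projection :: "('a \<Rightarrow> 'x measure) \<Rightarrow> 'a \<Rightarrow> ('x \<Rightarrow> real) \<Rightarrow> ('x \<Rightarrow> real) \<Rightarrow> bool" where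
  "is_tangent_projection P \<alpha> h \<phi> \<longleftrightarrow> \<phi> \<in> tangent_space P \<alpha> \<and>
     (\<forall>g\<in>scores P \<alpha>. integral\<^sup>L (P \<alpha>) (\<lambda>x. (h x - \<phi> x) * g x) = 0)"

end

theory Submission
  imports Defs
begin

text \<open>Algebraically \<open>W\<^sub>n - Z\<^sub>n\<close> is \<open>\<surd>n\<close> times the quantity in (M3) minus those in (M4)
  and (M5), which gives (ii), and (iii) is Slutsky's theorem in \<open>\<ell>\<^sup>\<infinity>\<close>: a bounded continuous
  function is uniformly continuous near a compact set carrying most of the mass of the tight limit.
  The Donsker property supplies the limit in (i); its finite-dimensional laws are identified by the
  central limit theorem and Levy uniqueness, and their covariance is \<open>E (h\<^sub>1 - \<Pi>h\<^sub>1)(h\<^sub>2 - \<Pi>h\<^sub>2)\<close>,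
  because scores of quadratic-mean differentiable submodels have mean zero and the residuals
  \<open>h - \<Pi>h\<close> are orthogonal to the tangent space.\<close>

section \<open>Uniform distance on bounded functions\<close>

text \<open>The processes need not be measurable as maps into \<open>linf\<close>, so only outer
  expectations are available, and these are not additive. This shapes the Slutsky argument: the
  errors are absorbed into single test functions \<open>f x + c * u x\<close> with \<open>c\<close>
  equal to plus or minus \<open>2 * B\<close>, where \<open>u\<close> is a continuous cutoff
  vanishing on the compact set, and weak convergence is applied to these rather than to
  \<open>f\<close> and \<open>u\<close> apart. Ordinary expectations return for finite linear
  combinations of coordinates of the score process, so characteristic functions can be used there.
  Neither \<open>scores\<close> nor \<open>tangent_space\<close> imposes mean zero. It is extracted
  from the square-root density expansion and then serves three times: the Donsker centring of the
  residuals disappears, the products of means in \<open>Cov\<close> vanish, and so does the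
  difference of the \<open>P \<alpha>0\<close>-means of \<open>h \<gamma> \<alpha>0\<close> and
  \<open>Pih \<gamma>\<close> that the algebra for (ii) leaves over. A projection is merely square
  integrable, so the residuals have no uniform bound: the central limit theorem sees only second
  moments, and boundedness of the paths of \<open>Zn\<close> comes from the Donsker
  property.\<close>

lemma linfI: "(\<And>\<gamma>. \<bar>x \<gamma>\<bar> \<le> B) \<Longrightarrow> x \<in> linf"
  by (auto simp: linf_def bounded_iff)

lemma linfE:
  assumes "x \<in> linf"
  obtains B where "\<And>\<gamma>. \<bar>x \<gamma>\<bar> \<le> B"
  using assms by (auto simp: linf_def bounded_iff)

text \<open>The supremum in \<open>supdist\<close> is a real one and dominates its terms only when
  the differences are bounded; hence the membership in \<open>linf\<close> that accompanies most
  later facts.\<close>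

lemma abs_diff_le_supdist:
  assumes "x \<in> linf" "y \<in> linf"
  shows "\<bar>x \<gamma> - y \<gamma>\<bar> \<le> supdist x y"
proof -
  obtain B C where B: "\<And>\<gamma>. \<bar>x \<gamma>\<bar> \<le> B" and C: "\<And>\<gamma>. \<bar>y \<gamma>\<bar> \<le> C"
    using assms by (metis linfE)
  have "\<bar>x \<gamma> - y \<gamma>\<bar> \<le> B + C" for \<gamma>
    using B[of \<gamma>] C[of \<gamma>] by linarith
  then show ?thesis
    unfolding supdist_def by (intro cSUP_upper bdd_aboveI2) auto
qed

lemma supdist_le: "(\<And>\<gamma>. \<bar>x \<gamma> - y \<gamma>\<bar> \<le> B) \<Longrightarrow> supdist x y \<le> B"
  unfolding supdist_def by (rule cSUP_least) auto

lemma supdist_commute: "supdist x y = supdist y x"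
  by (simp add: supdist_def abs_minus_commute)

lemma supdist_self [simp]: "supdist x x = 0"
  by (simp add: supdist_def)

lemma supdist_nonneg: "x \<in> linf \<Longrightarrow> y \<in> linf \<Longrightarrow> 0 \<le> supdist x y"
  by (rule order_trans[OF abs_ge_zero abs_diff_le_supdist])

lemma supdist_triangle:
  assumes "x \<in> linf" "y \<in> linf" "z \<in> linf"
  shows "supdist x z \<le> supdist x y + supdist y z"
proof (rule supdist_le)
  fix \<gamma>
  show "\<bar>x \<gamma> - z \<gamma>\<bar> \<le> supdist x y + supdist y z"
    using abs_diff_le_supdist[OF assms(1,2), of \<gamma>] abs_diff_le_supdist[OF assms(2,3), of \<gamma>] by linarith
qed

lemma supn_le_iff: "supn x \<le> ereal e \<longleftrightarrow> (\<forall>\<gamma>. \<bar>x \<gamma>\<bar> \<le> e)"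
  by (simp add: supn_def SUP_le_iff)

section \<open>Borel sets and bounded continuous test functions on \<open>linf\<close>\<close>

lemma space_linf_law:
  assumes "sets L = sets linf_borel"
  shows "space L = linf"
proof -
  have "{U. linf_open U} \<subseteq> Pow (linf :: ('a \<Rightarrow> real) set)"
    by (auto simp: linf_open_def)
  then show ?thesis
    using sets_eq_imp_space_eq[OF assms] by (simp add: linf_borel_def space_measure_of)
qed

lemma linf_open_in_sets: "linf_open U \<Longrightarrow> U \<in> sets linf_borel"
  unfolding linf_borel_def by (subst sets_measure_of) (auto simp: linf_open_def)

text \<open>Preimages of open sets are generators of \<open>linf_borel\<close>. Boundedness is left
  out on purpose: the result serves test functions and also the unbounded coordinate
  evaluations.\<close>

lemma borel_measurable_linf_continuous:
  fixes f :: "('g \<Rightarrow> real) \<Rightarrow> real"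
  assumes L: "sets L = sets linf_borel"
    and cont: "\<And>x e. x \<in> linf \<Longrightarrow> 0 < e \<Longrightarrow> \<exists>d>0. \<forall>y\<in>linf. supdist x y < d \<longrightarrow> \<bar>f y - f x\<bar> < e"
  shows "f \<in> borel_measurable L"
proof (rule borel_measurableI)
  fix S :: "real set"
  assume "open S"
  have "linf_open (f -` S \<inter> linf)"
    unfolding linf_open_def
  proof (intro conjI ballI)
    fix x assume x: "x \<in> f -` S \<inter> linf"
    then obtain e where e: "e > 0" "\<And>y. dist y (f x) < e \<Longrightarrow> y \<in> S"
      using \<open>open S\<close> unfolding open_dist by auto
    then obtain d where "d > 0" "\<And>y. y \<in> linf \<Longrightarrow> supdist x y < d \<Longrightarrow> \<bar>f y - f x\<bar> < e"
      using cont[of x e] x by auto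
    then show "\<exists>d>0. \<forall>y\<in>linf. supdist x y < d \<longrightarrow> y \<in> f -` S \<inter> linf"
      using e by (auto simp: dist_real_def intro!: exI[of _ d])
  qed auto
  then show "f -` S \<inter> space L \<in> sets L"
    using linf_open_in_sets L space_linf_law[OF L] by metis
qed

lemma bounded_cont_linfE:
  assumes "bounded_cont_linf f"
  obtains B where "B > 0" "\<And>x. \<bar>f x\<bar> \<le> B"
proof -
  obtain B where "\<And>x. \<bar>f x\<bar> \<le> B"
    using assms by (auto simp: bounded_cont_linf_def)
  then have "max 1 B > 0" "\<And>x. \<bar>f x\<bar> \<le> max 1 B"
    by (auto simp: le_max_iff_disj)
  then show thesis
    by (rule that)
qed

lemma bounded_cont_linf_at:
  assumes "bounded_cont_linf f" "x \<in> linf" "0 < e"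
  obtains d where "d > 0" "\<And>y. y \<in> linf \<Longrightarrow> supdist x y < d \<Longrightarrow> \<bar>f y - f x\<bar> < e"
  using assms unfolding bounded_cont_linf_def by blast

lemma bounded_cont_linf_measurable:
  assumes "bounded_cont_linf f" "sets L = sets linf_borel"
  shows "f \<in> borel_measurable L"
proof (rule borel_measurable_linf_continuous[OF assms(2)])
  fix x :: "'a \<Rightarrow> real" and e :: real
  assume "x \<in> linf" "0 < e"
  then show "\<exists>d>0. \<forall>y\<in>linf. supdist x y < d \<longrightarrow> \<bar>f y - f x\<bar> < e"
    using assms(1) by (simp add: bounded_cont_linf_def)
qed

lemma bounded_cont_linf_integrable:
  assumes "bounded_cont_linf f" "sets L = sets linf_borel" "prob_space L"
  shows "integrable L f"
proof -
  interpret prob_space L by fact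
  obtain B where "\<And>x. \<bar>f x\<bar> \<le> B"
    using bounded_cont_linfE[OF assms(1)] by blast
  then show ?thesis
    by (intro integrable_const_bound[where B=B] bounded_cont_linf_measurable assms) auto
qed

text \<open>Needed for a test function plus or minus a multiple of a cutoff, so that weak
  convergence can be applied to the combination at once.\<close>

lemma bounded_cont_linf_add_scaled:
  assumes f: "bounded_cont_linf f" and g: "bounded_cont_linf g"
  shows "bounded_cont_linf (\<lambda>x. f x + c * g x)"
  unfolding bounded_cont_linf_def
proof (intro conjI ballI allI impI)
  obtain B C where B: "\<And>x. \<bar>f x\<bar> \<le> B" and C: "\<And>x. \<bar>g x\<bar> \<le> C"
    using bounded_cont_linfE[OF f] bounded_cont_linfE[OF g] by metis
  have "\<bar>f x + c * g x\<bar> \<le> B + \<bar>c\<bar> * C" for x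
    using B[of x] mult_left_mono[OF C[of x], of "\<bar>c\<bar>"] abs_triangle_ineq[of "f x" "c * g x"]
    by (simp add: abs_mult)
  then show "\<exists>B. \<forall>x. \<bar>f x + c * g x\<bar> \<le> B"
    by blast
next
  fix x :: "'a \<Rightarrow> real" and e :: real
  assume x: "x \<in> linf" and "e > 0"
  \<comment> \<open>The summand 1 keeps the denominator positive when \<open>c = 0\<close>.\<close>
  then have e: "e / 2 > 0" "e / (2 * (\<bar>c\<bar> + 1)) > 0"
    by auto
  obtain d1 where d1: "d1 > 0" "\<And>y. y \<in> linf \<Longrightarrow> supdist x y < d1 \<Longrightarrow> \<bar>f y - f x\<bar> < e / 2"
    using bounded_cont_linf_at[OF f x e(1)] by blast
  obtain d2 where d2: "d2 > 0"
    "\<And>y. y \<in> linf \<Longrightarrow> supdist x y < d2 \<Longrightarrow> \<bar>g y - g x\<bar> < e / (2 * (\<bar>c\<bar> + 1))"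
    using bounded_cont_linf_at[OF g x e(2)] by blast
  have "\<bar>(f y + c * g y) - (f x + c * g x)\<bar> < e"
    if "y \<in> linf" "supdist x y < min d1 d2" for y
  proof -
    have "\<bar>c\<bar> * \<bar>g y - g x\<bar> \<le> (\<bar>c\<bar> + 1) * (e / (2 * (\<bar>c\<bar> + 1)))"
      using d2(2)[of y] that by (intro mult_mono) auto
    also have "\<dots> = e / 2"
      by (simp add: field_simps)
    finally have "\<bar>c * (g y - g x)\<bar> \<le> e / 2"
      by (simp add: abs_mult)
    moreover have "\<bar>f y - f x\<bar> < e / 2"
      using d1(2) that by simp
    moreover have "(f y + c * g y) - (f x + c * g x) = (f y - f x) + c * (g y - g x)"
      by (simp add: algebra_simps)
    ultimately show ?thesis
      by linarith
  qed
  then show "\<exists>d>0. \<forall>y\<in>linf. supdist x y < d \<longrightarrow> \<bar>(f y + c * g y) - (f x + c * g x)\<bar> < e"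
    using d1(1) d2(1) by (intro exI[of _ "min d1 d2"]) auto
qed

text \<open>More than Heine-Cantor on \<open>K\<close>: only one of the two points has to lie in
  \<open>K\<close>. If no \<open>d\<close> worked, bad pairs at distance below
  \<open>1 / Suc n\<close> would exist; along a subsequence both members approach the same
  \<open>x\<close> in \<open>K\<close>, where continuity brings both values within
  \<open>e / 2\<close> of \<open>f x\<close>.\<close>

lemma linf_compact_uniformly_continuous:
  assumes K: "linf_compact K" and f: "bounded_cont_linf f" and "e > 0"
  obtains d where "d > 0"
    "\<And>x y. x \<in> K \<Longrightarrow> y \<in> linf \<Longrightarrow> supdist x y < d \<Longrightarrow> \<bar>f y - f x\<bar> < e"
proof (rule ccontr)
  assume contr: "\<not> thesis"
  have "\<exists>x y. x \<in> K \<and> y \<in> linf \<and> supdist x y < 1 / Suc n \<and> \<bar>f y - f x\<bar> \<ge> e" for n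
    using contr that[of "1 / Suc n"] by force
  then obtain s t where st: "\<And>n. s n \<in> K" "\<And>n. t n \<in> linf"
    "\<And>n. supdist (s n) (t n) < 1 / Suc n" "\<And>n. \<bar>f (t n) - f (s n)\<bar> \<ge> e"
    by metis
  obtain r x where r: "strict_mono r" and x: "x \<in> K"
    and lim: "(\<lambda>n. supdist (s (r n)) x) \<longlonglongrightarrow> 0"
    using K st(1) unfolding linf_compact_def by blast
  have Kl: "K \<subseteq> linf"
    using K by (simp add: linf_compact_def)
  then have xl: "x \<in> linf"
    using x by auto
  obtain d where d: "d > 0" "\<And>y. y \<in> linf \<Longrightarrow> supdist x y < d \<Longrightarrow> \<bar>f y - f x\<bar> < e / 2"
    using bounded_cont_linf_at[OF f xl, of "e / 2"] \<open>e > 0\<close> by auto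
  have "(\<lambda>n. 1 / real (Suc (r n))) \<longlonglongrightarrow> 0"
    using LIMSEQ_subseq_LIMSEQ[OF LIMSEQ_inverse_real_of_nat r]
    by (simp add: comp_def inverse_eq_divide)
  then have "\<forall>\<^sub>F n in sequentially. 1 / real (Suc (r n)) < d / 2"
    using d(1) by (intro order_tendstoD) auto
  moreover have "\<forall>\<^sub>F n in sequentially. supdist (s (r n)) x < d / 2"
    using d(1) by (intro order_tendstoD[OF lim]) auto
  ultimately have "\<forall>\<^sub>F n in sequentially. False"
  proof eventually_elim
    case (elim n)
    have sl: "s (r n) \<in> linf"
      using st(1) Kl by auto
    have "supdist x (t (r n)) \<le> supdist x (s (r n)) + supdist (s (r n)) (t (r n))"
      using supdist_triangle xl sl st(2) by blast
    also have "\<dots> < d"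
      using elim st(3)[of "r n"] supdist_commute[of x] by fastforce
    finally have "\<bar>f (t (r n)) - f x\<bar> < e / 2"
      using d(2) st(2) by blast
    moreover have "\<bar>f (s (r n)) - f x\<bar> < e / 2"
      using d(2)[OF sl] d(1) elim(2) by (simp add: supdist_commute[of x])
    ultimately show False
      using st(4)[of "r n"] by linarith
  qed
  then show False
    by simp
qed

text \<open>Distance to a set for \<open>supdist\<close>; meaningful for nonempty \<open>K\<close>
  inside \<open>linf\<close> and \<open>z\<close> in \<open>linf\<close>. It supplies the continuous
  replacement for the indicator of the complement of \<open>K\<close>.\<close>

definition linf_infdist :: "('g \<Rightarrow> real) set \<Rightarrow> ('g \<Rightarrow> real) \<Rightarrow> real" where
  "linf_infdist K z = (INF k\<in>K. supdist z k)"

lemma linf_infdist_lipschitz: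
  assumes K: "K \<subseteq> linf" "K \<noteq> {}" and z: "z \<in> linf" "w \<in> linf"
  shows "linf_infdist K z \<le> linf_infdist K w + supdist z w"
proof -
  have bdd: "bdd_below (supdist z ` K)"
    using K z by (auto intro!: bdd_belowI2[of _ 0] supdist_nonneg)
  have "linf_infdist K z - supdist z w \<le> linf_infdist K w"
    unfolding linf_infdist_def[of K w]
  proof (rule cINF_greatest[OF K(2)])
    fix k assume k: "k \<in> K"
    have "linf_infdist K z \<le> supdist z k"
      unfolding linf_infdist_def using bdd k by (rule cINF_lower)
    also have "\<dots> \<le> supdist z w + supdist w k"
      using supdist_triangle z k K by blast
    finally show "linf_infdist K z - supdist z w \<le> supdist w k"
      by simp
  qed
  then show ?thesis
    by simp
qed

lemma linf_infdist_less:
  assumes "K \<noteq> {}" "linf_infdist K z < d"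
  obtains k where "k \<in> K" "supdist z k < d"
  using cInf_lessD[of "supdist z ` K" d] assms unfolding linf_infdist_def by auto

text \<open>One inequality is enough, because the cutoff built from the distance is truncated below
  at 0.\<close>

lemma linf_infdist_le_0:
  assumes "K \<subseteq> linf" "z \<in> K"
  shows "linf_infdist K z \<le> 0"
proof -
  have "bdd_below (supdist z ` K)"
    using assms by (auto intro!: bdd_belowI2[of _ 0] supdist_nonneg)
  then show ?thesis
    unfolding linf_infdist_def using cINF_lower[of "supdist z" K z] assms by simp
qed

text \<open>A Urysohn cutoff: 0 on \<open>K\<close>, 1 at distance \<open>d\<close> and beyond,
  Lipschitz with constant \<open>1 / d\<close> since clamping to the unit interval does not increase
  differences. Clamping on both sides also gives the bound at functions outside \<open>linf\<close>,
  which \<open>bounded_cont_linf\<close> demands.\<close>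

lemma bounded_cont_linf_infdist:
  assumes K: "K \<subseteq> linf" "K \<noteq> {}" and "d > 0"
  shows "bounded_cont_linf (\<lambda>z. max 0 (min 1 (linf_infdist K z / d)))"
  unfolding bounded_cont_linf_def
proof (intro conjI ballI allI impI)
  show "\<exists>B. \<forall>z. \<bar>max 0 (min 1 (linf_infdist K z / d))\<bar> \<le> B"
    by (intro exI[of _ 1]) auto
next
  fix x :: "'a \<Rightarrow> real" and e :: real
  assume x: "x \<in> linf" and "e > 0"
  have "\<bar>max 0 (min 1 (linf_infdist K y / d)) - max 0 (min 1 (linf_infdist K x / d))\<bar> < e"
    if y: "y \<in> linf" "supdist x y < e * d" for y
  proof -
    have "\<bar>linf_infdist K y - linf_infdist K x\<bar> \<le> supdist x y"
      using linf_infdist_lipschitz[OF K x y(1)] linf_infdist_lipschitz[OF K y(1) x]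
      by (simp add: supdist_commute[of y x])
    then have "\<bar>linf_infdist K y - linf_infdist K x\<bar> < e * d"
      using y(2) by linarith
    then have "\<bar>linf_infdist K y / d - linf_infdist K x / d\<bar> < e"
      using \<open>d > 0\<close> by (simp add: diff_divide_distrib[symmetric] pos_divide_less_eq)
    then show ?thesis
      by (auto simp: max_def min_def abs_if split: if_splits)
  qed
  then show "\<exists>c>0. \<forall>y\<in>linf. supdist x y < c \<longrightarrow>
      \<bar>max 0 (min 1 (linf_infdist K y / d)) - max 0 (min 1 (linf_infdist K x / d))\<bar> < e"
    using \<open>d > 0\<close> \<open>e > 0\<close> by (intro exI[of _ "e * d"]) auto
qed

section \<open>Outer probability and outer expectation\<close>

lemma outer_prob_nonneg: "0 \<le> outer_prob Q S"
  unfolding outer_prob_def by (rule cInf_greatest) auto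

lemma outer_prob_le_measure:
  assumes "B \<in> sets Q" "S \<inter> space Q \<subseteq> B"
  shows "outer_prob Q S \<le> measure Q B"
  unfolding outer_prob_def using assms by (intro cInf_lower bdd_belowI[of _ 0]) auto

lemma outer_prob_approx:
  assumes "e > 0"
  obtains B where "B \<in> sets Q" "S \<inter> space Q \<subseteq> B" "measure Q B < outer_prob Q S + e"
proof -
  have "\<exists>x\<in>{measure Q B |B. B \<in> sets Q \<and> S \<inter> space Q \<subseteq> B}. x < outer_prob Q S + e"
    using assms unfolding outer_prob_def by (intro cInf_lessD) auto
  then show thesis
    using that by blast
qed

lemma outer_prob_mono:
  assumes "S \<inter> space Q \<subseteq> T"
  shows "outer_prob Q S \<le> outer_prob Q T"
proof (rule field_le_epsilon)
  fix e :: real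
  assume "e > 0"
  then obtain B where "B \<in> sets Q" "T \<inter> space Q \<subseteq> B" "measure Q B < outer_prob Q T + e"
    by (rule outer_prob_approx)
  then show "outer_prob Q S \<le> outer_prob Q T + e"
    using outer_prob_le_measure[of B Q S] assms by force
qed

lemma outer_prob_Un:
  assumes "prob_space Q"
  shows "outer_prob Q (S \<union> T) \<le> outer_prob Q S + outer_prob Q T"
proof (rule field_le_epsilon)
  fix e :: real
  assume "e > 0"
  then have e2: "e / 2 > 0"
    by simp
  interpret prob_space Q by fact
  obtain A where A: "A \<in> sets Q" "S \<inter> space Q \<subseteq> A" "measure Q A < outer_prob Q S + e / 2"
    using e2 by (rule outer_prob_approx)
  obtain B where B: "B \<in> sets Q" "T \<inter> space Q \<subseteq> B" "measure Q B < outer_prob Q T + e / 2"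
    using e2 by (rule outer_prob_approx)
  have "outer_prob Q (S \<union> T) \<le> measure Q (A \<union> B)"
    using A B by (intro outer_prob_le_measure) auto
  also have "\<dots> \<le> measure Q A + measure Q B"
    using A B by (intro measure_Un_le) auto
  finally show "outer_prob Q (S \<union> T) \<le> outer_prob Q S + outer_prob Q T + e"
    using A B by simp
qed

text \<open>A real infimum lies below its members only if the set is bounded below. The bound on
  \<open>T\<close> ensures this: every majorant has integral at least \<open>- B\<close>.\<close>

lemma outer_exp_le_integral:
  assumes Q: "prob_space Q" and U: "integrable Q U" "\<And>\<omega>. \<omega> \<in> space Q \<Longrightarrow> T \<omega> \<le> U \<omega>"
    and T: "\<And>\<omega>. \<omega> \<in> space Q \<Longrightarrow> \<bar>T \<omega>\<bar> \<le> B"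
  shows "outer_exp Q T \<le> integral\<^sup>L Q U"
proof -
  interpret prob_space Q by fact
  have "- B \<le> integral\<^sup>L Q V" if V: "integrable Q V" "\<forall>\<omega>\<in>space Q. T \<omega> \<le> V \<omega>" for V
  proof (rule integral_ge_const[OF V(1)])
    show "AE \<omega> in Q. - B \<le> V \<omega>"
      using V(2) T by (intro AE_I2) (smt (verit))
  qed
  then show ?thesis
    unfolding outer_exp_def using U by (intro cInf_lower bdd_belowI[of _ "- B"]) auto
qed

lemma outer_exp_approx:
  assumes Q: "prob_space Q" and T: "\<And>\<omega>. \<omega> \<in> space Q \<Longrightarrow> \<bar>T \<omega>\<bar> \<le> B" and "e > 0"
  obtains U where "integrable Q U" "\<And>\<omega>. \<omega> \<in> space Q \<Longrightarrow> T \<omega> \<le> U \<omega>"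
    "integral\<^sup>L Q U < outer_exp Q T + e"
proof -
  interpret prob_space Q by fact
  let ?S = "{integral\<^sup>L Q U | U. U \<in> borel_measurable Q \<and> integrable Q U \<and> (\<forall>\<omega>\<in>space Q. T \<omega> \<le> U \<omega>)}"
  have "integral\<^sup>L Q (\<lambda>_. B) \<in> ?S"
    using T by (intro CollectI exI[of _ "\<lambda>_. B"]) (auto simp: abs_le_iff)
  then have "\<exists>x\<in>?S. x < outer_exp Q T + e"
    using \<open>e > 0\<close> unfolding outer_exp_def by (intro cInf_lessD) auto
  then show thesis
    using that by blast
qed

text \<open>A bounded measurable function is its own least majorant. This leads from
  Hoffmann-Joergensen convergence back to ordinary integrals for finite-dimensional
  functionals.\<close>

lemma outer_exp_eq_integral:
  assumes Q: "prob_space Q" and T: "T \<in> borel_measurable Q"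
    "\<And>\<omega>. \<omega> \<in> space Q \<Longrightarrow> \<bar>T \<omega>\<bar> \<le> B"
  shows "outer_exp Q T = integral\<^sup>L Q T"
proof (rule antisym)
  interpret prob_space Q by fact
  have int: "integrable Q T"
    using T by (intro integrable_const_bound[where B=B]) auto
  then show "outer_exp Q T \<le> integral\<^sup>L Q T"
    using T by (intro outer_exp_le_integral[OF Q]) auto
  show "integral\<^sup>L Q T \<le> outer_exp Q T"
  proof (rule field_le_epsilon)
    fix e :: real
    assume "e > 0"
    obtain U where "integrable Q U" "\<And>\<omega>. \<omega> \<in> space Q \<Longrightarrow> T \<omega> \<le> U \<omega>"
      "integral\<^sup>L Q U < outer_exp Q T + e"
      by (rule outer_exp_approx[where Q=Q and T=T and B=B and e=e]) (use Q T(2) \<open>e > 0\<close> in auto)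
    then show "integral\<^sup>L Q T \<le> outer_exp Q T + e"
      using integral_mono[OF int, of U] by fastforce
  qed
qed

text \<open>A nearly optimal majorant of \<open>T'\<close>, plus \<open>c\<close>, plus
  \<open>b\<close> times the indicator of a measurable cover of \<open>S\<close>, is a majorant of
  \<open>T\<close>. This takes the place of additivity when two nonmeasurable quantities are close
  off the exceptional set \<open>S\<close>.\<close>

lemma outer_exp_compare:
  assumes Q: "prob_space Q"
    and T: "\<And>\<omega>. \<omega> \<in> space Q \<Longrightarrow> \<bar>T \<omega>\<bar> \<le> B" and T': "\<And>\<omega>. \<omega> \<in> space Q \<Longrightarrow> \<bar>T' \<omega>\<bar> \<le> B'"
    and le: "\<And>\<omega>. \<omega> \<in> space Q \<Longrightarrow> T \<omega> \<le> T' \<omega> + c + b * indicator S \<omega>" and "b \<ge> 0"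
  shows "outer_exp Q T \<le> outer_exp Q T' + c + b * outer_prob Q S"
proof (rule field_le_epsilon)
  fix e :: real
  assume "e > 0"
  interpret prob_space Q by fact
  obtain U where U: "integrable Q U" "\<And>\<omega>. \<omega> \<in> space Q \<Longrightarrow> T' \<omega> \<le> U \<omega>"
    "integral\<^sup>L Q U < outer_exp Q T' + e / 2"
    by (rule outer_exp_approx[where Q=Q and T=T' and B=B' and e="e / 2"])
      (use Q T' \<open>e > 0\<close> in auto)
  \<comment> \<open>The cover of \<open>S\<close> may cost this much, so that after multiplication
    by \<open>b\<close> at most \<open>e / 2\<close> is lost; the summand 1 covers
    \<open>b = 0\<close>.\<close>
  have "e / (2 * (b + 1)) > 0"
    using \<open>e > 0\<close> \<open>b \<ge> 0\<close> by simp
  then obtain A where A: "A \<in> sets Q" "S \<inter> space Q \<subseteq> A"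
    "measure Q A < outer_prob Q S + e / (2 * (b + 1))"
    by (rule outer_prob_approx)
  have int: "integrable Q (indicator A :: _ \<Rightarrow> real)"
    using A(1) by (simp add: integrable_indicator_iff less_top[symmetric])
  have "outer_exp Q T \<le> integral\<^sup>L Q (\<lambda>\<omega>. U \<omega> + c + b * indicator A \<omega>)"
  proof (rule outer_exp_le_integral[OF Q _ _ T])
    show "integrable Q (\<lambda>\<omega>. U \<omega> + c + b * indicator A \<omega>)"
      using U(1) int by auto
    fix \<omega> assume \<omega>: "\<omega> \<in> space Q"
    have "indicator S \<omega> \<le> (indicator A \<omega> :: real)"
      using A(2) \<omega> by (auto simp: indicator_def)
    then have "b * indicator S \<omega> \<le> b * indicator A \<omega>"
      using \<open>b \<ge> 0\<close> by (rule mult_left_mono)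
    then show "T \<omega> \<le> U \<omega> + c + b * indicator A \<omega>"
      using le[OF \<omega>] U(2)[OF \<omega>] by linarith
  qed
  also have "\<dots> = integral\<^sup>L Q U + c + b * measure Q A"
    using U(1) int A(1) by (simp add: prob_space)
  also have "b * measure Q A \<le> b * outer_prob Q S + e / 2"
  proof -
    have "b * measure Q A \<le> b * (outer_prob Q S + e / (2 * (b + 1)))"
      using A(3) \<open>b \<ge> 0\<close> by (intro mult_left_mono) auto
    also have "\<dots> \<le> b * outer_prob Q S + e / 2"
      using \<open>b \<ge> 0\<close> \<open>e > 0\<close> by (simp add: field_simps)
    finally show ?thesis .
  qed
  finally show "outer_exp Q T \<le> outer_exp Q T' + c + b * outer_prob Q S + e"
    using U(3) by simp
qed

section \<open>Slutsky's theorem\<close>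

text \<open>If \<open>z\<close> is near \<open>K\<close>, both values are compared through a nearby
  point of \<open>K\<close>, where uniform continuity applies. If \<open>z\<close> is far from
  \<open>K\<close>, the cutoff equals 1 and the trivial bound \<open>2 * B\<close> takes over. The
  right side depends on \<open>z\<close> alone and continuously, so it can enter a test
  function.\<close>

lemma linf_compact_oscillation_bound:
  assumes K: "linf_compact K" "K \<noteq> {}" and f: "bounded_cont_linf f" and B: "\<And>x. \<bar>f x\<bar> \<le> B"
    and "\<epsilon> > 0"
  obtains d where "d > 0" "\<And>z w. z \<in> linf \<Longrightarrow> w \<in> linf \<Longrightarrow> supdist w z \<le> d \<Longrightarrow>
    \<bar>f w - f z\<bar> \<le> \<epsilon> + 2 * B * max 0 (min 1 (linf_infdist K z / d))"
proof -
  obtain d where d: "d > 0"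
    "\<And>x y. x \<in> K \<Longrightarrow> y \<in> linf \<Longrightarrow> supdist x y < d \<Longrightarrow> \<bar>f y - f x\<bar> < \<epsilon> / 2"
    using linf_compact_uniformly_continuous[OF K(1) f, of "\<epsilon> / 2"] \<open>\<epsilon> > 0\<close> by auto
  have Kl: "K \<subseteq> linf"
    using K by (simp add: linf_compact_def)
  have "B \<ge> 0"
    using B abs_ge_zero order_trans by blast
  have "\<bar>f w - f z\<bar> \<le> \<epsilon> + 2 * B * max 0 (min 1 (linf_infdist K z / (d / 2)))"
    if zw: "z \<in> linf" "w \<in> linf" "supdist w z \<le> d / 2" for z w
  proof (cases "linf_infdist K z < d / 2")
    case True
    then obtain k where k: "k \<in> K" "supdist z k < d / 2"
      using linf_infdist_less[OF K(2)] by blast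
    have "supdist k w \<le> supdist k z + supdist z w"
      using supdist_triangle zw k Kl by blast
    then have "supdist k w < d" "supdist k z < d"
      using k zw(3) d(1) by (auto simp: supdist_commute[of k z] supdist_commute[of z w])
    then have "\<bar>f w - f k\<bar> < \<epsilon> / 2" "\<bar>f z - f k\<bar> < \<epsilon> / 2"
      using d(2) k zw by blast+
    moreover have "0 \<le> 2 * B * max 0 (min 1 (linf_infdist K z / (d / 2)))"
      using \<open>B \<ge> 0\<close> by simp
    ultimately show ?thesis
      by linarith
  next
    case False
    then have "max 0 (min 1 (linf_infdist K z / (d / 2))) = 1"
      using d(1) by (simp add: field_simps)
    then show ?thesis
      using B[of w] B[of z] \<open>\<epsilon> > 0\<close> by (simp only: mult_1_right)
  qed
  \<comment> \<open>Half the radius of uniform continuity: \<open>w\<close> is reached from the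
    point of \<open>K\<close> in two steps of at most \<open>d / 2\<close>, the first one
    strict.\<close>
  then show thesis
    using that[of "d / 2"] d(1) by auto
qed

text \<open>Off the event that \<open>Y n\<close> and \<open>X n\<close> differ by more than
  \<open>d\<close>, the change in \<open>f\<close> is at most a constant plus
  \<open>2 * B * u (X n \<omega>)\<close>. The limit of this last term is small because
  \<open>u\<close> vanishes on a compact set carrying most of \<open>L\<close>; no such set is
  required for the laws of \<open>X n\<close>.\<close>

lemma weak_conv_HJ_Slutsky:
  fixes L :: "('g \<Rightarrow> real) measure"
  assumes Q: "prob_space Q" and L: "tight_borel_law L" and X: "weak_conv_HJ Q X L"
    and Xl: "\<And>n \<omega>. \<omega> \<in> space Q \<Longrightarrow> X n \<omega> \<in> linf"
    and Yl: "\<And>n \<omega>. \<omega> \<in> space Q \<Longrightarrow> Y n \<omega> \<in> linf"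
    and XY: "oP1 Q (\<lambda>n \<omega>. supn (\<lambda>\<gamma>. Y n \<omega> \<gamma> - X n \<omega> \<gamma>))"
  shows "weak_conv_HJ Q Y L"
  unfolding weak_conv_HJ_def
proof (intro allI impI LIMSEQ_I)
  fix f :: "('g \<Rightarrow> real) \<Rightarrow> real" and \<eta> :: real
  assume f: "bounded_cont_linf f" and \<eta>: "0 < \<eta>"
  have pL: "prob_space L" and sL: "sets L = sets linf_borel"
    using L by (auto simp: tight_borel_law_def)
  interpret L: prob_space L by fact
  obtain B where B: "B > 0" "\<And>x. \<bar>f x\<bar> \<le> B"
    using bounded_cont_linfE[OF f] by blast
  \<comment> \<open>The bound 1/2 forces \<open>K\<close> to have positive mass, hence to be
    nonempty; the other bound makes \<open>2 * B * e\<close> at most a quarter of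
    \<open>\<eta>\<close>.\<close>
  define e where "e = min (1/2) (\<eta> / (8 * B))"
  have e: "e > 0" "e \<le> 1/2" "2 * B * e \<le> \<eta> / 4"
    using B \<eta> by (auto simp: e_def min_def field_simps)
  obtain K where K: "linf_compact K" "K \<in> sets L" "measure L K \<ge> 1 - e"
    using L e(1) unfolding tight_borel_law_def by blast
  have Kl: "K \<subseteq> linf"
    using K by (simp add: linf_compact_def)
  have "K \<noteq> {}"
    using K(3) e(2) by auto
  then obtain d where d: "d > 0" "\<And>z w. z \<in> linf \<Longrightarrow> w \<in> linf \<Longrightarrow> supdist w z \<le> d \<Longrightarrow>
      \<bar>f w - f z\<bar> \<le> \<eta> / 4 + 2 * B * max 0 (min 1 (linf_infdist K z / d))"
    using linf_compact_oscillation_bound[OF K(1) _ f B(2), of "\<eta> / 4"] \<eta> by auto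
  define u where "u = (\<lambda>z. max 0 (min 1 (linf_infdist K z / d)))"
  have u: "bounded_cont_linf u"
    unfolding u_def using Kl \<open>K \<noteq> {}\<close> d(1) by (rule bounded_cont_linf_infdist)
  have u01: "0 \<le> u z" "u z \<le> 1" for z
    by (auto simp: u_def)
  have intf: "integrable L f" and intu: "integrable L u"
    using bounded_cont_linf_integrable f u pL sL by auto
  have "integral\<^sup>L L u \<le> integral\<^sup>L L (\<lambda>z. 1 - indicator K z)"
  proof (rule integral_mono[OF intu])
    show "integrable L (\<lambda>z. 1 - indicator K z :: real)"
      using K(2) by (simp add: integrable_indicator_iff less_top[symmetric])
    show "u z \<le> 1 - indicator K z" for z
      using linf_infdist_le_0[OF Kl, of z] d(1) u01[of z]
      by (auto simp: u_def indicator_def divide_le_0_iff min_def max_def)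
  qed
  also have "\<dots> = 1 - measure L K"
    using K(2) by (simp add: integrable_indicator_iff less_top[symmetric] L.prob_space)
  finally have "integral\<^sup>L L u \<le> e"
    using K(3) by simp
  then have Bu: "2 * B * integral\<^sup>L L u \<le> \<eta> / 4"
    using e(3) B(1) mult_left_mono[of "integral\<^sup>L L u" e "2 * B"] by linarith
  define S where "S n = {\<omega> \<in> space Q. supn (\<lambda>\<gamma>. Y n \<omega> \<gamma> - X n \<omega> \<gamma>) > ereal d}" for n
  have "(\<lambda>n. outer_prob Q (S n)) \<longlonglongrightarrow> 0"
    using XY d(1) unfolding oP1_def S_def by blast
  then have "\<forall>\<^sub>F n in sequentially. outer_prob Q (S n) < \<eta> / (8 * B)"
    using B(1) \<eta> by (intro order_tendstoD(2)) auto
  moreover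
  \<comment> \<open>The sign of \<open>c\<close> is free: \<open>2 * B\<close> serves the upper
    estimate and \<open>- 2 * B\<close> the lower one.\<close>
  have lim: "(\<lambda>n. outer_exp Q (\<lambda>\<omega>. f (X n \<omega>) + c * u (X n \<omega>))) \<longlonglongrightarrow> integral\<^sup>L L f + c * integral\<^sup>L L u" for c
    using X bounded_cont_linf_add_scaled[OF f u, of c] intf intu
    unfolding weak_conv_HJ_def by fastforce
  have "\<forall>\<^sub>F n in sequentially. outer_exp Q (\<lambda>\<omega>. f (X n \<omega>) + 2 * B * u (X n \<omega>))
      < integral\<^sup>L L f + 2 * B * integral\<^sup>L L u + \<eta> / 4"
    using \<eta> by (intro order_tendstoD(2)[OF lim]) auto
  moreover have "\<forall>\<^sub>F n in sequentially. outer_exp Q (\<lambda>\<omega>. f (X n \<omega>) + (- 2 * B) * u (X n \<omega>))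
      > integral\<^sup>L L f + (- 2 * B) * integral\<^sup>L L u - \<eta> / 4"
    using \<eta> by (intro order_tendstoD(1)[OF lim]) auto
  \<comment> \<open>Four quarters of \<open>\<eta>\<close>: oscillation near \<open>K\<close>, limit
    mass away from \<open>K\<close>, outer probability of \<open>S n\<close>, and the error in weak
    convergence.\<close>
  ultimately have "\<forall>\<^sub>F n in sequentially. norm (outer_exp Q (\<lambda>\<omega>. f (Y n \<omega>)) - integral\<^sup>L L f) < \<eta>"
  proof eventually_elim
    case (elim n)
    have Sp: "2 * B * outer_prob Q (S n) < \<eta> / 4"
      using elim(1) B(1) by (simp add: field_simps)
    have bdd: "\<bar>f x + c * u x\<bar> \<le> B + \<bar>c\<bar>" for x c
    proof -
      have "\<bar>c * u x\<bar> \<le> \<bar>c\<bar> * 1"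
        unfolding abs_mult using u01[of x] by (intro mult_left_mono) auto
      then show ?thesis
        using B(2)[of x] by linarith
    qed
    have close: "\<bar>f (Y n \<omega>) - f (X n \<omega>)\<bar> \<le> \<eta> / 4 + 2 * B * u (X n \<omega>) + 2 * B * indicator (S n) \<omega>"
      if \<omega>: "\<omega> \<in> space Q" for \<omega>
    proof (cases "\<omega> \<in> S n")
      case True
      have "0 \<le> 2 * B * u (X n \<omega>)"
        using B(1) u01 by simp
      then show ?thesis
        using True B(2)[of "Y n \<omega>"] B(2)[of "X n \<omega>"] \<eta> by simp
    next
      case False
      then have "supn (\<lambda>\<gamma>. Y n \<omega> \<gamma> - X n \<omega> \<gamma>) \<le> ereal d"
        using \<omega> by (simp add: S_def)
      then have "supdist (Y n \<omega>) (X n \<omega>) \<le> d"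
        unfolding supn_le_iff by (intro supdist_le) auto
      then show ?thesis
        using d(2)[OF Xl[OF \<omega>] Yl[OF \<omega>]] False by (simp add: u_def)
    qed
    have "outer_exp Q (\<lambda>\<omega>. f (Y n \<omega>)) \<le>
        outer_exp Q (\<lambda>\<omega>. f (X n \<omega>) + 2 * B * u (X n \<omega>)) + \<eta> / 4 + 2 * B * outer_prob Q (S n)"
    proof (rule outer_exp_compare[OF Q B(2) bdd])
      show "f (Y n \<omega>) \<le> f (X n \<omega>) + 2 * B * u (X n \<omega>) + \<eta> / 4 + 2 * B * indicator (S n) \<omega>"
        if "\<omega> \<in> space Q" for \<omega>
        using close[OF that] by linarith
    qed (use B(1) in auto)
    moreover have "outer_exp Q (\<lambda>\<omega>. f (X n \<omega>) + (- 2 * B) * u (X n \<omega>)) \<le>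
        outer_exp Q (\<lambda>\<omega>. f (Y n \<omega>)) + \<eta> / 4 + 2 * B * outer_prob Q (S n)"
    proof (rule outer_exp_compare[OF Q bdd B(2)])
      show "f (X n \<omega>) + (- 2 * B) * u (X n \<omega>) \<le> f (Y n \<omega>) + \<eta> / 4 + 2 * B * indicator (S n) \<omega>"
        if "\<omega> \<in> space Q" for \<omega>
        using close[OF that] by (simp add: abs_le_iff)
    qed (use B(1) in auto)
    ultimately show ?case
      using elim(2,3) Sp Bu by (simp add: abs_less_iff)
  qed
  then show "\<exists>n0. \<forall>n\<ge>n0. norm (outer_exp Q (\<lambda>\<omega>. f (Y n \<omega>)) - integral\<^sup>L L f) < \<eta>"
    by (simp add: eventually_sequentially)
qed

section \<open>Gaussian finite-dimensional laws\<close>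

text \<open>A finite linear combination of coordinates is Lipschitz for \<open>supdist\<close>, with
  constant the sum of the absolute coefficients, so sine and cosine of it are admissible test
  functions.\<close>

lemma bounded_cont_linf_compose_linear:
  fixes \<phi> :: "real \<Rightarrow> real" and c :: "'g \<Rightarrow> real"
  assumes cont: "continuous_on UNIV \<phi>" and bdd: "\<And>y. \<bar>\<phi> y\<bar> \<le> B"
  shows "bounded_cont_linf (\<lambda>x. \<phi> (\<Sum>i\<in>S. c i * x i))"
  unfolding bounded_cont_linf_def
proof (intro conjI ballI allI impI)
  show "\<exists>B. \<forall>x. \<bar>\<phi> (\<Sum>i\<in>S. c i * x i)\<bar> \<le> B"
    using bdd by blast
next
  fix x :: "'g \<Rightarrow> real" and e :: real
  assume x: "x \<in> linf" and "e > 0"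
  \<comment> \<open>The summand 1 keeps \<open>C\<close> positive when all coefficients
    vanish.\<close>
  define C where "C = (\<Sum>i\<in>S. \<bar>c i\<bar>) + 1"
  have "C > 0"
    unfolding C_def by (intro add_nonneg_pos sum_nonneg) auto
  obtain d where d: "d > 0"
    "\<And>z. dist z (\<Sum>i\<in>S. c i * x i) < d \<Longrightarrow> dist (\<phi> z) (\<phi> (\<Sum>i\<in>S. c i * x i)) < e"
    using cont \<open>e > 0\<close> unfolding continuous_on_iff by (metis UNIV_I)
  have "\<bar>\<phi> (\<Sum>i\<in>S. c i * y i) - \<phi> (\<Sum>i\<in>S. c i * x i)\<bar> < e"
    if y: "y \<in> linf" "supdist x y < d / C" for y
  proof -
    have "\<bar>(\<Sum>i\<in>S. c i * y i) - (\<Sum>i\<in>S. c i * x i)\<bar> \<le> (\<Sum>i\<in>S. \<bar>c i\<bar> * supdist x y)"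
      unfolding sum_subtractf[symmetric] right_diff_distrib[symmetric]
    proof (rule order_trans[OF sum_abs sum_mono])
      show "\<bar>c i * (y i - x i)\<bar> \<le> \<bar>c i\<bar> * supdist x y" for i
        unfolding abs_mult using abs_diff_le_supdist[OF y(1) x, of i]
        by (intro mult_left_mono) (auto simp: supdist_commute)
    qed
    also have "\<dots> = (C - 1) * supdist x y"
      by (simp add: C_def sum_distrib_right)
    also have "\<dots> \<le> C * supdist x y"
      using supdist_nonneg[OF x y(1)] by (intro mult_right_mono) auto
    also have "\<dots> < d"
      using y(2) \<open>C > 0\<close> by (simp add: field_simps)
    finally show ?thesis
      using d(2) by (simp add: dist_real_def)
  qed
  then show "\<exists>d>0. \<forall>y\<in>linf. supdist x y < d \<longrightarrow>
      \<bar>\<phi> (\<Sum>i\<in>S. c i * y i) - \<phi> (\<Sum>i\<in>S. c i * x i)\<bar> < e"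
    using d(1) \<open>C > 0\<close> by (intro exI[of _ "d / C"]) auto
qed

lemma linear_functional_linf_measurable:
  assumes "sets L = sets linf_borel"
  shows "(\<lambda>x. \<Sum>i\<in>S. c i * x i) \<in> borel_measurable L"
proof (intro borel_measurable_sum borel_measurable_times borel_measurable_const
    borel_measurable_linf_continuous[OF assms])
  fix i and x :: "'a \<Rightarrow> real" and e :: real
  assume x: "x \<in> linf" and "e > 0"
  have "\<bar>y i - x i\<bar> < e" if "y \<in> linf" "supdist x y < e" for y
    using abs_diff_le_supdist[OF that(1) x, of i] that(2) by (simp add: supdist_commute)
  then show "\<exists>d>0. \<forall>y\<in>linf. supdist x y < d \<longrightarrow> \<bar>y i - x i\<bar> < e"
    using \<open>e > 0\<close> by blast
qed

text \<open>Test functions in \<open>weak_conv_HJ\<close> are real valued, so the characteristic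
  function is split into its cosine and sine parts.\<close>

lemma char_distr_eq:
  assumes "prob_space Q" and Y: "Y \<in> borel_measurable Q"
  shows "char (distr Q borel Y) t =
    complex_of_real (integral\<^sup>L Q (\<lambda>\<omega>. cos (t * Y \<omega>))) + \<i> * complex_of_real (integral\<^sup>L Q (\<lambda>\<omega>. sin (t * Y \<omega>)))"
proof -
  interpret prob_space Q by fact
  have [measurable]: "Y \<in> borel_measurable Q"
    by fact
  have "integrable Q (\<lambda>\<omega>. cos (t * Y \<omega>))" "integrable Q (\<lambda>\<omega>. sin (t * Y \<omega>))"
    by (auto intro!: integrable_const_bound[where B=1])
  then have int: "integrable Q (\<lambda>\<omega>. complex_of_real (cos (t * Y \<omega>)))"
    "integrable Q (\<lambda>\<omega>. complex_of_real (sin (t * Y \<omega>)))"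
    by auto
  have "char (distr Q borel Y) t = (CLINT \<omega>|Q. iexp (t * Y \<omega>))"
    unfolding char_def by (subst integral_distr) auto
  also have "\<dots> = (CLINT \<omega>|Q. complex_of_real (cos (t * Y \<omega>)) + \<i> * complex_of_real (sin (t * Y \<omega>)))"
    by (intro Bochner_Integration.integral_cong refl)
      (simp add: cis_conv_exp[symmetric] cis.ctr complex_eq_iff del: of_real_mult)
  also have "\<dots> = complex_of_real (integral\<^sup>L Q (\<lambda>\<omega>. cos (t * Y \<omega>))) + \<i> * complex_of_real (integral\<^sup>L Q (\<lambda>\<omega>. sin (t * Y \<omega>)))"
    using int by simp
  finally show ?thesis .
qed

text \<open>The combinations are measurable, so the outer expectations of their sines and cosines
  are integrals, and weak convergence gives the limits of both parts.\<close>

lemma weak_conv_HJ_char: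
  fixes L :: "('g \<Rightarrow> real) measure"
  assumes Q: "prob_space Q" and L: "tight_borel_law L" and X: "weak_conv_HJ Q X L"
    and meas: "\<And>n. (\<lambda>\<omega>. \<Sum>i\<in>S. c i * X n \<omega> i) \<in> borel_measurable Q"
  shows "(\<lambda>n. char (distr Q borel (\<lambda>\<omega>. \<Sum>i\<in>S. c i * X n \<omega> i)) t)
    \<longlonglongrightarrow> char (distr L borel (\<lambda>x. \<Sum>i\<in>S. c i * x i)) t"
proof -
  have pL: "prob_space L" and sL: "sets L = sets linf_borel"
    using L by (auto simp: tight_borel_law_def)
  have lim: "(\<lambda>n. integral\<^sup>L Q (\<lambda>\<omega>. \<phi> (t * (\<Sum>i\<in>S. c i * X n \<omega> i))))
      \<longlonglongrightarrow> integral\<^sup>L L (\<lambda>x. \<phi> (t * (\<Sum>i\<in>S. c i * x i)))"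
    if \<phi>: "continuous_on UNIV \<phi>" "\<And>y. \<bar>\<phi> y\<bar> \<le> 1" for \<phi> :: "real \<Rightarrow> real"
  proof -
    have "continuous_on UNIV (\<lambda>y. \<phi> (t * y))"
      by (intro continuous_on_compose2[OF \<phi>(1)] continuous_intros) auto
    then have "bounded_cont_linf (\<lambda>x. \<phi> (t * (\<Sum>i\<in>S. c i * x i)))"
      using bounded_cont_linf_compose_linear[where \<phi>="\<lambda>y. \<phi> (t * y)" and B=1] \<phi>(2) by blast
    then have "(\<lambda>n. outer_exp Q (\<lambda>\<omega>. \<phi> (t * (\<Sum>i\<in>S. c i * X n \<omega> i))))
        \<longlonglongrightarrow> integral\<^sup>L L (\<lambda>x. \<phi> (t * (\<Sum>i\<in>S. c i * x i)))"
      using X unfolding weak_conv_HJ_def by blast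
    moreover have "outer_exp Q (\<lambda>\<omega>. \<phi> (t * (\<Sum>i\<in>S. c i * X n \<omega> i))) =
        integral\<^sup>L Q (\<lambda>\<omega>. \<phi> (t * (\<Sum>i\<in>S. c i * X n \<omega> i)))" for n
    proof (rule outer_exp_eq_integral[OF Q _ \<phi>(2)])
      have "\<phi> \<in> borel_measurable borel"
        using \<phi>(1) by (rule borel_measurable_continuous_onI)
      then show "(\<lambda>\<omega>. \<phi> (t * (\<Sum>i\<in>S. c i * X n \<omega> i))) \<in> borel_measurable Q"
        using measurable_compose[of "\<lambda>\<omega>. t * (\<Sum>i\<in>S. c i * X n \<omega> i)" Q borel \<phi>]
          borel_measurable_times[OF borel_measurable_const meas] by blast
    qed
    ultimately show ?thesis
      by simp
  qed
  show ?thesis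
    unfolding char_distr_eq[OF Q meas] char_distr_eq[OF pL linear_functional_linf_measurable[OF sL]]
    by (intro tendsto_intros lim continuous_on_cos continuous_on_sin continuous_on_id) auto
qed

section \<open>The i.i.d. sample space and the central limit theorem\<close>

lemma prob_space_iid_space: "prob_space Q \<Longrightarrow> prob_space (iid_space Q)"
  unfolding iid_space_def by (rule prob_space_PiM)

lemma measurable_iid_coordinate: "(\<lambda>\<omega>. \<omega> i) \<in> measurable (iid_space Q) Q"
  unfolding iid_space_def by (rule measurable_component_singleton) simp

lemma distr_iid_coordinate: "prob_space Q \<Longrightarrow> distr (iid_space Q) Q (\<lambda>\<omega>. \<omega> i) = Q"
  unfolding iid_space_def by (rule distr_PiM_component) auto

lemma integral_iid_coordinate:
  fixes g :: "'x \<Rightarrow> real"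
  assumes "prob_space Q" "g \<in> borel_measurable Q"
  shows "integral\<^sup>L (iid_space Q) (\<lambda>\<omega>. g (\<omega> i)) = integral\<^sup>L Q g"
  using integral_distr[OF measurable_iid_coordinate[of i Q] assms(2)] distr_iid_coordinate[OF assms(1)]
  by simp

lemma integrable_iid_coordinate:
  fixes g :: "'x \<Rightarrow> real"
  assumes "prob_space Q" "integrable Q g"
  shows "integrable (iid_space Q) (\<lambda>\<omega>. g (\<omega> i))"
  using integrable_distr[OF measurable_iid_coordinate[of i Q], of g] distr_iid_coordinate[OF assms(1)] assms(2)
  by simp

text \<open>On the product space the tuple of all coordinates is the identity, so its law is the
  product of the marginals.\<close>

lemma indep_vars_iid_coordinate:
  assumes Q: "prob_space Q"
  shows "prob_space.indep_vars (iid_space Q) (\<lambda>i. Q) (\<lambda>i \<omega>. \<omega> i) UNIV"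
proof -
  interpret prob_space "iid_space Q"
    by (rule prob_space_iid_space[OF Q])
  show ?thesis
  proof (subst indep_vars_iff_distr_eq_PiM')
    show "distr (iid_space Q) (Pi\<^sub>M UNIV (\<lambda>i. Q)) (\<lambda>x. \<lambda>i\<in>UNIV. x i) =
        Pi\<^sub>M UNIV (\<lambda>i. distr (iid_space Q) Q (\<lambda>\<omega>. \<omega> i))"
      unfolding distr_iid_coordinate[OF Q] restrict_UNIV
      by (simp add: iid_space_def distr_id2)
  qed (auto intro: measurable_iid_coordinate)
qed

text \<open>Restricted to unit variance; other variances are reached by rescaling coefficients, and
  variance 0 is treated apart.\<close>

lemma iid_central_limit_char:
  fixes g :: "'x \<Rightarrow> real"
  assumes Q: "prob_space Q" and g: "g \<in> borel_measurable Q" "integrable Q (\<lambda>x. (g x)\<^sup>2)"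
    and mean: "integral\<^sup>L Q g = 0" and var: "integral\<^sup>L Q (\<lambda>x. (g x)\<^sup>2) = 1"
  shows "(\<lambda>n. char (distr (iid_space Q) borel (\<lambda>\<omega>. (\<Sum>i<n. g (\<omega> i)) / sqrt n)) t)
    \<longlonglongrightarrow> char std_normal_distribution t"
proof (rule levy_continuity1)
  interpret prob_space "iid_space Q"
    by (rule prob_space_iid_space[OF Q])
  have meas [measurable]: "(\<lambda>\<omega>. g (\<omega> i)) \<in> borel_measurable (iid_space Q)" for i
    using measurable_iid_coordinate g(1) by (rule measurable_compose)
  have mean0: "expectation (\<lambda>\<omega>. g (\<omega> i)) = 0" for i
    using integral_iid_coordinate[OF Q g(1)] mean by simp
  have "weak_conv_m (\<lambda>n. distr (iid_space Q) borel (\<lambda>\<omega>. (\<Sum>i<n. g (\<omega> i)) / sqrt (real n * 1\<^sup>2)))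
      std_normal_distribution"
  proof (rule central_limit_theorem_zero_mean[where \<mu>="distr Q borel g"])
    show "indep_vars (\<lambda>i. borel) (\<lambda>i \<omega>. g (\<omega> i)) UNIV"
      using indep_vars_iid_coordinate[OF Q] g(1) by (rule indep_vars_compose2)
    show "integrable (iid_space Q) (\<lambda>\<omega>. (g (\<omega> n))\<^sup>2)" for n
      by (rule integrable_iid_coordinate[OF Q g(2)])
    show "variance (\<lambda>\<omega>. g (\<omega> n)) = 1\<^sup>2" for n
      unfolding mean0 using integral_iid_coordinate[OF Q, of "\<lambda>x. (g x)\<^sup>2" n] g var by simp
    show "distr (iid_space Q) borel (\<lambda>\<omega>. g (\<omega> n)) = distr Q borel g" for n
      using distr_distr[OF g(1) measurable_iid_coordinate[of n Q]] distr_iid_coordinate[OF Q]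
      by (simp add: comp_def)
  qed (auto simp: mean0)
  then show "weak_conv_m (\<lambda>n. distr (iid_space Q) borel (\<lambda>\<omega>. (\<Sum>i<n. g (\<omega> i)) / sqrt n))
      std_normal_distribution"
    by simp
  show "real_distribution (distr (iid_space Q) borel (\<lambda>\<omega>. (\<Sum>i<n. g (\<omega> i)) / sqrt n))" for n
    by (rule real_distribution_distr) simp
qed (rule real_dist_normal_dist)

section \<open>Square-integrable functions and identification of the Gaussian law\<close>

lemma integrable_mult_square_integrable:
  fixes f g :: "'x \<Rightarrow> real"
  assumes "f \<in> borel_measurable Q" "integrable Q (\<lambda>x. (f x)\<^sup>2)"
    and "g \<in> borel_measurable Q" "integrable Q (\<lambda>x. (g x)\<^sup>2)"
  shows "integrable Q (\<lambda>x. f x * g x)"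
proof (rule Bochner_Integration.integrable_bound[OF Bochner_Integration.integrable_add[OF assms(2,4)]])
  show "AE x in Q. norm (f x * g x) \<le> norm ((f x)\<^sup>2 + (g x)\<^sup>2)"
  proof (rule AE_I2)
    fix x
    have "2 * (\<bar>f x\<bar> * \<bar>g x\<bar>) \<le> \<bar>f x\<bar>\<^sup>2 + \<bar>g x\<bar>\<^sup>2"
      using sum_squares_bound[of "\<bar>f x\<bar>" "\<bar>g x\<bar>"] by simp
    moreover have "0 \<le> \<bar>f x\<bar> * \<bar>g x\<bar>"
      by simp
    ultimately have "\<bar>f x\<bar> * \<bar>g x\<bar> \<le> \<bar>f x\<bar>\<^sup>2 + \<bar>g x\<bar>\<^sup>2"
      by linarith
    then show "norm (f x * g x) \<le> norm ((f x)\<^sup>2 + (g x)\<^sup>2)"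
      by (simp add: abs_mult)
  qed
qed (use assms in auto)

lemma square_integrable_add:
  fixes f g :: "'x \<Rightarrow> real"
  assumes "f \<in> borel_measurable Q" "integrable Q (\<lambda>x. (f x)\<^sup>2)"
    and "g \<in> borel_measurable Q" "integrable Q (\<lambda>x. (g x)\<^sup>2)"
  shows "integrable Q (\<lambda>x. (f x + g x)\<^sup>2)"
  using assms integrable_mult_square_integrable[OF assms]
  by (simp add: power2_sum mult.assoc)

lemma square_integrable_sum:
  fixes f :: "'i \<Rightarrow> 'x \<Rightarrow> real"
  assumes "finite S" "\<And>i. i \<in> S \<Longrightarrow> f i \<in> borel_measurable Q"
    "\<And>i. i \<in> S \<Longrightarrow> integrable Q (\<lambda>x. (f i x)\<^sup>2)"
  shows "integrable Q (\<lambda>x. (\<Sum>i\<in>S. c i * f i x)\<^sup>2)"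
  using assms
proof (induction S rule: finite_induct)
  case (insert j S)
  have "integrable Q (\<lambda>x. (c j * f j x + (\<Sum>i\<in>S. c i * f i x))\<^sup>2)"
    using insert by (intro square_integrable_add) (auto simp: power_mult_distrib)
  then show ?case
    using insert by simp
qed simp

text \<open>For each coefficient vector the same characteristic functions have two limits: one from
  weak convergence to \<open>L\<close>, one from the central limit theorem for the real-valued
  function \<open>G a\<close>. Levy uniqueness identifies the law of the functional under
  \<open>L\<close>.\<close>

lemma centered_gaussian_lawI:
  fixes L :: "('g \<Rightarrow> real) measure"
  assumes Q: "prob_space Q"
    and f: "\<And>\<gamma>. f \<gamma> \<in> borel_measurable Q" "\<And>\<gamma>. integrable Q (\<lambda>x. (f \<gamma> x)\<^sup>2)"
    and mean: "\<And>\<gamma>. integral\<^sup>L Q (f \<gamma>) = 0"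
    and L: "tight_borel_law L"
    and conv: "weak_conv_HJ (iid_space Q) (\<lambda>n \<omega> \<gamma>. (\<Sum>i<n. f \<gamma> (\<omega> i)) / sqrt n) L"
  shows "centered_gaussian_law L (\<lambda>\<gamma>1 \<gamma>2. integral\<^sup>L Q (\<lambda>x. f \<gamma>1 x * f \<gamma>2 x))"
  unfolding centered_gaussian_law_def Let_def
proof (intro allI impI)
  fix S :: "'g set" and c :: "'g \<Rightarrow> real"
  assume S: "finite S"
  interpret Q: prob_space Q by fact
  have pI: "prob_space (iid_space Q)"
    using Q by (rule prob_space_iid_space)
  interpret I: prob_space "iid_space Q" by fact
  have pL: "prob_space L" and sL: "sets L = sets linf_borel"
    using L by (auto simp: tight_borel_law_def)
  interpret L: prob_space L by fact
  define G where "G a x = (\<Sum>\<gamma>\<in>S. a \<gamma> * f \<gamma> x)" for a x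
  define T where "T a x = (\<Sum>\<gamma>\<in>S. a \<gamma> * x \<gamma>)" for a :: "'g \<Rightarrow> real" and x
  define v where "v = (\<Sum>i\<in>S. \<Sum>j\<in>S. c i * c j * integral\<^sup>L Q (\<lambda>x. f i x * f j x))"
  have Gm [measurable]: "G a \<in> borel_measurable Q" for a
    unfolding G_def using f(1) by measurable
  have Gs: "integrable Q (\<lambda>x. (G a x)\<^sup>2)" for a
    unfolding G_def using S f by (rule square_integrable_sum)
  have fi: "integrable Q (f \<gamma>)" for \<gamma>
    using Q.square_integrable_imp_integrable f by blast
  have G0: "integral\<^sup>L Q (G a) = 0" for a
    unfolding G_def using fi mean by simp
  have Tm [measurable]: "T a \<in> borel_measurable L" for a
    unfolding T_def by (rule linear_functional_linf_measurable[OF sL])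
  have GT: "(\<Sum>\<gamma>\<in>S. a \<gamma> * ((\<Sum>i<n. f \<gamma> (\<omega> i)) / sqrt n)) = (\<Sum>i<n. G a (\<omega> i)) / sqrt n" for a \<omega> and n :: nat
    unfolding G_def sum_divide_distrib sum_distrib_left times_divide_eq_right by (rule sum.swap)
  have sm: "(\<lambda>\<omega>. (\<Sum>i<n. G a (\<omega> i)) / sqrt n) \<in> borel_measurable (iid_space Q)" for a n
    by (intro borel_measurable_divide borel_measurable_sum borel_measurable_const
        measurable_compose[OF measurable_iid_coordinate Gm])
  have char_lim: "(\<lambda>n. char (distr (iid_space Q) borel (\<lambda>\<omega>. (\<Sum>i<n. G a (\<omega> i)) / sqrt n)) t)
      \<longlonglongrightarrow> char (distr L borel (T a)) t" for a t
    using weak_conv_HJ_char[OF pI L conv, where S=S and c=a and t=t] sm unfolding GT T_def by blast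
  \<comment> \<open>Reading the quadratic form as a second moment shows that it is nonnegative and
    that it vanishes only if \<open>G c\<close> is 0 almost everywhere.\<close>
  have v: "v = integral\<^sup>L Q (\<lambda>x. (G c x)\<^sup>2)"
  proof -
    have "(G c x)\<^sup>2 = (\<Sum>i\<in>S. \<Sum>j\<in>S. c i * c j * (f i x * f j x))" for x
      unfolding G_def power2_eq_square sum_product by (simp add: algebra_simps)
    moreover have "integrable Q (\<lambda>x. f i x * f j x)" for i j
      by (intro integrable_mult_square_integrable f)
    ultimately show ?thesis
      by (simp add: v_def)
  qed
  show "distr L borel (\<lambda>x. \<Sum>i\<in>S. c i * x i) =
    (if (\<Sum>i\<in>S. \<Sum>j\<in>S. c i * c j * integral\<^sup>L Q (\<lambda>x. f i x * f j x)) = 0 then return borel 0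
     else density lborel (\<lambda>y. ennreal (normal_density 0
       (sqrt (\<Sum>i\<in>S. \<Sum>j\<in>S. c i * c j * integral\<^sup>L Q (\<lambda>x. f i x * f j x))) y)))"
    unfolding v_def[symmetric]
    unfolding T_def[symmetric]
  proof (cases "v = 0")
    \<comment> \<open>No normalisation by \<open>sqrt v\<close> is possible here; instead all the
      sums are 0 almost surely, so the limit law is a point mass.\<close>
    case True
    then have "AE x in Q. G c x = 0"
      using integral_nonneg_eq_0_iff_AE[OF Gs, of c] v by simp
    then have "AE x in distr (iid_space Q) Q (\<lambda>\<omega>. \<omega> i). G c x = 0" for i
      unfolding distr_iid_coordinate[OF Q] .
    then have "AE \<omega> in iid_space Q. G c (\<omega> i) = 0" for i
      using AE_distrD[OF measurable_iid_coordinate] by blast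
    then have "AE \<omega> in iid_space Q. \<forall>i. G c (\<omega> i) = 0"
      by (simp add: AE_all_countable)
    then have "AE \<omega> in iid_space Q. (\<Sum>i<n. G c (\<omega> i)) / sqrt n = 0" for n
      by eventually_elim simp
    then have "distr (iid_space Q) borel (\<lambda>\<omega>. (\<Sum>i<n. G c (\<omega> i)) / sqrt n) = distr (iid_space Q) borel (\<lambda>_. 0)" for n
      using sm by (intro distr_cong_AE) auto
    then have "char (distr L borel (T c)) t = char (distr (iid_space Q) borel (\<lambda>_. 0)) t" for t
      using char_lim[of c t] LIMSEQ_unique[OF _ tendsto_const] by simp
    moreover have "distr (iid_space Q) borel (\<lambda>_. 0 :: real) = return borel 0"
      by (rule I.distr_const) simp
    ultimately have "char (distr L borel (T c)) = char (return borel 0)"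
      by auto
    moreover have "real_distribution (return borel (0::real))"
      by (auto simp: real_distribution_def real_distribution_axioms_def intro!: prob_space_return)
    ultimately have "distr L borel (T c) = return borel 0"
      by (intro Levy_uniqueness) auto
    then show "distr L borel (T c) = (if v = 0 then return borel 0
        else density lborel (\<lambda>y. ennreal (normal_density 0 (sqrt v) y)))"
      using True by simp
  next
    case False
    have "v \<ge> 0"
      unfolding v by simp
    then have "sqrt v > 0"
      using False by simp
    \<comment> \<open>Dividing the coefficients by \<open>sqrt v\<close> gives unit variance; the
      scaling is undone after the law has been identified.\<close>
    define a where "a \<gamma> = c \<gamma> / sqrt v" for \<gamma>
    have Ga: "G a x = G c x / sqrt v" and Ta: "T a y = T c y / sqrt v" for x y
      by (simp_all add: G_def T_def a_def sum_divide_distrib)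
    have "integral\<^sup>L Q (\<lambda>x. (G a x)\<^sup>2) = 1"
      using \<open>v \<ge> 0\<close> False by (simp add: Ga power_divide v[symmetric])
    then have "(\<lambda>n. char (distr (iid_space Q) borel (\<lambda>\<omega>. (\<Sum>i<n. G a (\<omega> i)) / sqrt n)) t)
        \<longlonglongrightarrow> char std_normal_distribution t" for t
      using Q Gm Gs G0 by (intro iid_central_limit_char) auto
    then have "char (distr L borel (T a)) t = char std_normal_distribution t" for t
      using LIMSEQ_unique char_lim by blast
    then have "distr L borel (T a) = std_normal_distribution"
      by (intro Levy_uniqueness real_dist_normal_dist) auto
    then have "distributed L lborel (\<lambda>x. (T c x - 0) / sqrt v) std_normal_density"
      unfolding distributed_def Ta by (simp cong: distr_cong)
    then have "distributed L lborel (T c) (normal_density 0 (sqrt v))"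
      using L.normal_standard_normal_convert[OF \<open>sqrt v > 0\<close>] by blast
    then have "distr L borel (T c) = density lborel (normal_density 0 (sqrt v))"
      unfolding distributed_def by (simp cong: distr_cong)
    then show "distr L borel (T c) = (if v = 0 then return borel 0
        else density lborel (\<lambda>y. ennreal (normal_density 0 (sqrt v) y)))"
      using False by simp
  qed
qed

section \<open>Scores and the tangent space\<close>

lemma integrable_density_prob:
  assumes p: "p \<in> borel_measurable \<mu>" "\<And>x. p x \<ge> 0" and pr: "prob_space (density \<mu> (\<lambda>x. ennreal (p x)))"
  shows "integrable \<mu> p" "integral\<^sup>L \<mu> p = 1"
proof -
  have "(\<integral>\<^sup>+ x. ennreal (p x) \<partial>\<mu>) = (\<integral>\<^sup>+ x. ennreal (p x) * indicator (space \<mu>) x \<partial>\<mu>)"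
    by (intro nn_integral_cong) simp
  also have "\<dots> = emeasure (density \<mu> (\<lambda>x. ennreal (p x))) (space \<mu>)"
    using p(1) by (subst emeasure_density) auto
  also have "\<dots> = ennreal 1"
    using prob_space.emeasure_space_1[OF pr] by simp
  finally have "integrable \<mu> p \<and> integral\<^sup>L \<mu> p = 1"
    by (subst (asm) nn_integral_eq_integrable) (use p in simp_all)
  then show "integrable \<mu> p" "integral\<^sup>L \<mu> p = 1"
    by simp_all
qed

text \<open>With \<open>s = \<surd>q - \<surd>p\<close> and remainder \<open>r = s - t/2 g \<surd>p\<close>, one has
  \<open>q - p = s\<^sup>2 + 2 r \<surd>p + t g p\<close>; integrating the left side gives \<open>0\<close>, and the weight \<open>t * \<kappa>\<close>
  in the AM-GM bound for \<open>2 r \<surd>p\<close> keeps every error term \<open>o(t)\<close> up to \<open>t * \<kappa>\<close>.\<close>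
lemma score_mean_bound:
  fixes p q g :: "'x \<Rightarrow> real"
  assumes p: "p \<in> borel_measurable \<mu>" "\<And>x. p x \<ge> 0" "prob_space (density \<mu> (\<lambda>x. ennreal (p x)))"
    and q: "q \<in> borel_measurable \<mu>" "\<And>x. q x \<ge> 0" "prob_space (density \<mu> (\<lambda>x. ennreal (q x)))"
    and g: "g \<in> borel_measurable \<mu>" "integrable (density \<mu> (\<lambda>x. ennreal (p x))) (\<lambda>x. (g x)\<^sup>2)"
    and r: "(\<integral>\<^sup>+ x. ennreal ((sqrt (q x) - sqrt (p x) - t / 2 * g x * sqrt (p x))\<^sup>2) \<partial>\<mu>)
      \<le> ennreal (t\<^sup>2 * d)"
    and "t > 0" "d \<ge> 0" "\<kappa> > 0"
  shows "\<bar>integral\<^sup>L (density \<mu> (\<lambda>x. ennreal (p x))) g\<bar>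
    \<le> 2 * t * d + d / \<kappa> + t / 2 * integral\<^sup>L (density \<mu> (\<lambda>x. ennreal (p x))) (\<lambda>x. (g x)\<^sup>2) + \<kappa>"
proof -
  let ?P = "density \<mu> (\<lambda>x. ennreal (p x))"
  define \<rho> where "\<rho> x = sqrt (q x) - sqrt (p x) - t / 2 * g x * sqrt (p x)" for x
  define k where "k = t * \<kappa>"
  have "k > 0"
    using \<open>t > 0\<close> \<open>\<kappa> > 0\<close> by (simp add: k_def)
  note [measurable] = p(1) q(1) g(1)
  note ip = integrable_density_prob[OF p] and iq = integrable_density_prob[OF q]
  have \<rho>m [measurable]: "\<rho> \<in> borel_measurable \<mu>"
    unfolding \<rho>_def by measurable
  have i\<rho>: "integrable \<mu> (\<lambda>x. (\<rho> x)\<^sup>2)"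
  proof (rule integrableI_nonneg)
    show "(\<integral>\<^sup>+ x. ennreal ((\<rho> x)\<^sup>2) \<partial>\<mu>) < \<infinity>"
      using r unfolding \<rho>_def by (rule le_less_trans) simp
  qed auto
  have "ennreal (integral\<^sup>L \<mu> (\<lambda>x. (\<rho> x)\<^sup>2)) \<le> ennreal (t\<^sup>2 * d)"
    using r nn_integral_eq_integral[OF i\<rho>] unfolding \<rho>_def by simp
  then have R: "integral\<^sup>L \<mu> (\<lambda>x. (\<rho> x)\<^sup>2) \<le> t\<^sup>2 * d"
    using \<open>d \<ge> 0\<close> by (simp add: ennreal_le_iff)
  have ig2: "integrable \<mu> (\<lambda>x. p x * (g x)\<^sup>2)"
    and Ig2: "integral\<^sup>L ?P (\<lambda>x. (g x)\<^sup>2) = integral\<^sup>L \<mu> (\<lambda>x. p x * (g x)\<^sup>2)"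
    using g(2) p(2) integrable_density[of "\<lambda>x. (g x)\<^sup>2" \<mu> p] integral_density[of "\<lambda>x. (g x)\<^sup>2" \<mu> p]
    by simp_all
  have "integrable ?P g"
    by (rule finite_measure.square_integrable_imp_integrable[OF prob_space.finite_measure[OF p(3)] _ g(2)]) simp
  then have ig: "integrable \<mu> (\<lambda>x. p x * g x)"
    and Ig: "integral\<^sup>L ?P g = integral\<^sup>L \<mu> (\<lambda>x. p x * g x)"
    using p(2) integrable_density[of g \<mu> p] integral_density[of g \<mu> p]
    by simp_all
  have pt: "\<bar>t * (p x * g x) - (q x - p x)\<bar>
      \<le> (2 + 1 / k) * (\<rho> x)\<^sup>2 + t\<^sup>2 / 2 * (p x * (g x)\<^sup>2) + k * p x" for x
  proof -
    define a where "a = sqrt (p x)"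
    define b where "b = sqrt (q x)"
    have ab: "p x = a\<^sup>2" "q x = b\<^sup>2"
      using p(2) q(2) by (auto simp: a_def b_def)
    have \<rho>: "\<rho> x = b - a - t / 2 * g x * a"
      by (simp add: \<rho>_def a_def b_def)
    have "t * (p x * g x) - (q x - p x) = - ((\<rho> x + t / 2 * g x * a)\<^sup>2 + 2 * (\<rho> x * a))"
      unfolding \<rho> ab by (simp add: power2_eq_square algebra_simps)
    \<comment> \<open>The bound (x + y)^2 <= 2 x^2 + 2 y^2 for the squared difference of root
      densities; the defect is the square (x - y)^2.\<close>
    moreover have "(\<rho> x + t / 2 * g x * a)\<^sup>2 \<le> 2 * (\<rho> x)\<^sup>2 + t\<^sup>2 / 2 * (p x * (g x)\<^sup>2)"
    proof -
      have "2 * (\<rho> x)\<^sup>2 + t\<^sup>2 / 2 * (p x * (g x)\<^sup>2) - (\<rho> x + t / 2 * g x * a)\<^sup>2 = (\<rho> x - t / 2 * g x * a)\<^sup>2"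
        unfolding ab by (simp add: power2_eq_square algebra_simps)
      then show ?thesis
        using zero_le_power2[of "\<rho> x - t / 2 * g x * a"] by linarith
    qed
    moreover have "\<bar>2 * (\<rho> x * a)\<bar> \<le> 1 / k * (\<rho> x)\<^sup>2 + k * p x"
    proof -
      have "0 \<le> (\<bar>\<rho> x\<bar> - k * \<bar>a\<bar>)\<^sup>2 / k"
        using \<open>k > 0\<close> by simp
      also have "\<dots> = 1 / k * \<bar>\<rho> x\<bar>\<^sup>2 + k * \<bar>a\<bar>\<^sup>2 - 2 * (\<bar>\<rho> x\<bar> * \<bar>a\<bar>)"
        using \<open>k > 0\<close> by (simp add: power2_diff field_simps power2_eq_square del: abs_mult_self_eq)
      finally show ?thesis
        by (simp add: ab abs_mult)
    qed
    moreover have "0 \<le> (\<rho> x + t / 2 * g x * a)\<^sup>2"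
      by simp
    ultimately show ?thesis
      unfolding distrib_right[of 2 "1 / k"] by linarith
  qed
  have iR: "integrable \<mu> (\<lambda>x. (2 + 1 / k) * (\<rho> x)\<^sup>2 + t\<^sup>2 / 2 * (p x * (g x)\<^sup>2) + k * p x)"
    using i\<rho> ig2 ip(1) by (intro Bochner_Integration.integrable_add integrable_mult_right) auto
  have "t * integral\<^sup>L \<mu> (\<lambda>x. p x * g x) = integral\<^sup>L \<mu> (\<lambda>x. t * (p x * g x) - (q x - p x))"
    using ig ip iq by simp
  then have "\<bar>t * integral\<^sup>L \<mu> (\<lambda>x. p x * g x)\<bar> = \<bar>integral\<^sup>L \<mu> (\<lambda>x. t * (p x * g x) - (q x - p x))\<bar>"
    by simp
  also have "\<dots> \<le> integral\<^sup>L \<mu> (\<lambda>x. (2 + 1 / k) * (\<rho> x)\<^sup>2 + t\<^sup>2 / 2 * (p x * (g x)\<^sup>2) + k * p x)"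
    using ig ip(1) iq(1)
    by (intro order_trans[OF integral_abs_bound] integral_mono[OF _ iR pt] integrable_abs) auto
  also have "\<dots> = (2 + 1 / k) * integral\<^sup>L \<mu> (\<lambda>x. (\<rho> x)\<^sup>2)
      + t\<^sup>2 / 2 * integral\<^sup>L \<mu> (\<lambda>x. p x * (g x)\<^sup>2) + k"
    using i\<rho> ig2 ip by simp
  also have "\<dots> \<le> (2 + 1 / k) * (t\<^sup>2 * d) + t\<^sup>2 / 2 * integral\<^sup>L \<mu> (\<lambda>x. p x * (g x)\<^sup>2) + k"
    using R \<open>k > 0\<close> by (intro add_right_mono mult_left_mono) auto
  also have "\<dots> = t * (2 * t * d + d / \<kappa> + t / 2 * integral\<^sup>L \<mu> (\<lambda>x. p x * (g x)\<^sup>2) + \<kappa>)"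
    using \<open>t > 0\<close> \<open>\<kappa> > 0\<close> by (simp add: k_def power2_eq_square field_simps)
  finally show ?thesis
    using \<open>t > 0\<close> by (simp add: Ig Ig2 abs_mult)
qed

text \<open>In the preceding bound \<open>t\<close> tends to 0 with \<open>\<kappa>\<close> fixed,
  which leaves \<open>\<kappa>\<close>; this weight is arbitrary.\<close>

lemma score_mean_zero:
  fixes P :: "'a \<Rightarrow> 'x measure"
  assumes P: "\<And>\<beta>. prob_space (P \<beta>)" and g: "g \<in> scores P \<alpha>"
  shows "integral\<^sup>L (P \<alpha>) g = 0"
proof -
  obtain pth where pth: "qmd_score P \<alpha> pth g"
    using g by (auto simp: scores_def)
  then obtain D where D: "(D \<longlongrightarrow> 0) (at_right 0)"
    and ev: "\<forall>\<^sub>F t in at_right 0. \<exists>\<mu> p q. sigma_finite_measure \<mu> \<and>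
            p \<in> borel_measurable \<mu> \<and> q \<in> borel_measurable \<mu> \<and>
            (\<forall>x. p x \<ge> 0) \<and> (\<forall>x. q x \<ge> 0) \<and>
            P \<alpha> = density \<mu> (\<lambda>x. ennreal (p x)) \<and>
            P (pth t) = density \<mu> (\<lambda>x. ennreal (q x)) \<and>
            (\<integral>\<^sup>+ x. ennreal ((sqrt (q x) - sqrt (p x) - t / 2 * g x * sqrt (p x))\<^sup>2) \<partial>\<mu>)
               \<le> ennreal (t\<^sup>2 * D t)"
    and gm: "g \<in> borel_measurable (P \<alpha>)" and g2: "integrable (P \<alpha>) (\<lambda>x. (g x)\<^sup>2)"
    unfolding qmd_score_def by blast
  have "\<bar>integral\<^sup>L (P \<alpha>) g\<bar> \<le> \<kappa>" if "\<kappa> > 0" for \<kappa> :: real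
  proof (rule tendsto_lowerbound)
    \<comment> \<open>\<open>qmd_score\<close> prescribes no sign for \<open>D t\<close>, whereas
      the bound needs a nonnegative remainder; the positive part still tends to 0.\<close>
    let ?b = "\<lambda>t. 2 * t * max 0 (D t) + max 0 (D t) / \<kappa> + t / 2 * integral\<^sup>L (P \<alpha>) (\<lambda>x. (g x)\<^sup>2) + \<kappa>"
    have "(?b \<longlongrightarrow> 2 * 0 * max 0 0 + max 0 0 / \<kappa> + 0 / 2 * integral\<^sup>L (P \<alpha>) (\<lambda>x. (g x)\<^sup>2) + \<kappa>) (at_right 0)"
      using that by (intro tendsto_intros D) auto
    then show "(?b \<longlongrightarrow> \<kappa>) (at_right 0)"
      by simp
    show "\<forall>\<^sub>F t in at_right 0. \<bar>integral\<^sup>L (P \<alpha>) g\<bar> \<le> ?b t"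
      using ev eventually_at_right_less[of "0::real"]
    proof eventually_elim
      case (elim t)
      then obtain \<mu> p q where pq: "p \<in> borel_measurable \<mu>" "q \<in> borel_measurable \<mu>"
          "\<And>x. p x \<ge> 0" "\<And>x. q x \<ge> 0"
          "P \<alpha> = density \<mu> (\<lambda>x. ennreal (p x))" "P (pth t) = density \<mu> (\<lambda>x. ennreal (q x))"
        and r: "(\<integral>\<^sup>+ x. ennreal ((sqrt (q x) - sqrt (p x) - t / 2 * g x * sqrt (p x))\<^sup>2) \<partial>\<mu>)
          \<le> ennreal (t\<^sup>2 * D t)"
        by blast
      have "ennreal (t\<^sup>2 * D t) \<le> ennreal (t\<^sup>2 * max 0 (D t))"
        by (intro ennreal_leI mult_left_mono) auto
      note r' = order_trans[OF r this]
      show ?case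
        unfolding pq(5)
      proof (rule score_mean_bound[OF _ _ _ _ _ _ _ _ r'])
        show "prob_space (density \<mu> (\<lambda>x. ennreal (p x)))" "prob_space (density \<mu> (\<lambda>x. ennreal (q x)))"
          using P[of \<alpha>] P[of "pth t"] unfolding pq(5,6) .
        show "g \<in> borel_measurable \<mu>"
          using gm unfolding pq(5) by simp
        show "integrable (density \<mu> (\<lambda>x. ennreal (p x))) (\<lambda>x. (g x)\<^sup>2)"
          using g2 unfolding pq(5) .
      qed (use pq(1-4) elim(2) that in simp_all)
    qed
  qed simp
  then have "\<bar>integral\<^sup>L (P \<alpha>) g\<bar> \<le> 0"
    by (rule field_le_epsilon) simp
  then show ?thesis
    by simp
qed

text \<open>Orthogonality passes from scores to finite combinations by linearity, then to their
  closure: replacing \<open>f\<close> by its distance to an approximating combination leaves the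
  inner product with \<open>w\<close> unchanged, and weighted AM-GM bounds what remains.\<close>

lemma tangent_space_orthogonal:
  fixes w f :: "'x \<Rightarrow> real"
  assumes w: "w \<in> borel_measurable (P \<alpha>)" "integrable (P \<alpha>) (\<lambda>x. (w x)\<^sup>2)"
    and orth: "\<And>g. g \<in> scores P \<alpha> \<Longrightarrow> integral\<^sup>L (P \<alpha>) (\<lambda>x. w x * g x) = 0"
    and f: "f \<in> tangent_space P \<alpha>"
  shows "integral\<^sup>L (P \<alpha>) (\<lambda>x. w x * f x) = 0"
proof -
  let ?W = "integral\<^sup>L (P \<alpha>) (\<lambda>x. (w x)\<^sup>2)"
  have fm: "f \<in> borel_measurable (P \<alpha>)" "integrable (P \<alpha>) (\<lambda>x. (f x)\<^sup>2)"
    using f by (auto simp: tangent_space_def)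
  have bound: "\<bar>integral\<^sup>L (P \<alpha>) (\<lambda>x. w x * f x)\<bar> \<le> \<kappa> * (?W + 1)" if "\<kappa> > 0" for \<kappa>
  proof -
    \<comment> \<open>Accuracy \<open>\<kappa>\<^sup>2\<close> in squared norm, since the AM-GM
      bound divides this term by \<open>\<kappa>\<close>.\<close>
    have "\<kappa>\<^sup>2 > 0"
      using that by simp
    then obtain S c where S: "finite S" "S \<subseteq> scores P \<alpha>"
      and app: "integral\<^sup>L (P \<alpha>) (\<lambda>x. (f x - (\<Sum>g\<in>S. c g * g x))\<^sup>2) < \<kappa>\<^sup>2"
      using f unfolding tangent_space_def by blast
    have gS: "g \<in> borel_measurable (P \<alpha>)" "integrable (P \<alpha>) (\<lambda>x. (g x)\<^sup>2)" if "g \<in> S" for g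
      using S(2) that by (auto simp: scores_def qmd_score_def)
    define s where "s x = (\<Sum>g\<in>S. c g * g x)" for x
    have sm: "s \<in> borel_measurable (P \<alpha>)"
      unfolding s_def using gS(1) by measurable
    have s2: "integrable (P \<alpha>) (\<lambda>x. (s x)\<^sup>2)"
      unfolding s_def using S(1) gS by (rule square_integrable_sum[where f="\<lambda>g. g"])
    define u where "u x = f x - s x" for x
    have um: "u \<in> borel_measurable (P \<alpha>)"
      unfolding u_def using fm sm by measurable
    have u2: "integrable (P \<alpha>) (\<lambda>x. (u x)\<^sup>2)"
      using square_integrable_add[of f "P \<alpha>" "\<lambda>x. - s x"] fm sm s2 by (simp add: u_def)
    have iwg: "integrable (P \<alpha>) (\<lambda>x. w x * g x)" if "g \<in> S" for g
      by (intro integrable_mult_square_integrable w gS that)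
    have iwf: "integrable (P \<alpha>) (\<lambda>x. w x * f x)" and iws: "integrable (P \<alpha>) (\<lambda>x. w x * s x)"
      and iwu: "integrable (P \<alpha>) (\<lambda>x. w x * u x)"
      by (intro integrable_mult_square_integrable w fm sm s2 um u2)+
    have "integral\<^sup>L (P \<alpha>) (\<lambda>x. w x * s x) = integral\<^sup>L (P \<alpha>) (\<lambda>x. \<Sum>g\<in>S. c g * (w x * g x))"
      unfolding s_def by (simp add: sum_distrib_left mult.left_commute)
    also have "\<dots> = (\<Sum>g\<in>S. c g * integral\<^sup>L (P \<alpha>) (\<lambda>x. w x * g x))"
      using iwg by (subst Bochner_Integration.integral_sum) auto
    also have "\<dots> = 0"
      using orth S(2) by (intro sum.neutral) auto
    finally have "integral\<^sup>L (P \<alpha>) (\<lambda>x. w x * f x) = integral\<^sup>L (P \<alpha>) (\<lambda>x. w x * u x)"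
      using iwf iws by (simp add: u_def right_diff_distrib)
    also have "\<bar>\<dots>\<bar> \<le> integral\<^sup>L (P \<alpha>) (\<lambda>x. \<bar>w x * u x\<bar>)"
      by (rule integral_abs_bound)
    also have "\<dots> \<le> integral\<^sup>L (P \<alpha>) (\<lambda>x. \<kappa> * (w x)\<^sup>2 + 1 / \<kappa> * (u x)\<^sup>2)"
    proof (rule integral_mono)
      show "\<bar>w x * u x\<bar> \<le> \<kappa> * (w x)\<^sup>2 + 1 / \<kappa> * (u x)\<^sup>2" for x
      proof -
        have "0 \<le> (\<kappa> * \<bar>w x\<bar> - \<bar>u x\<bar>)\<^sup>2 / \<kappa>"
          using that by simp
        also have "\<dots> = \<kappa> * \<bar>w x\<bar>\<^sup>2 + 1 / \<kappa> * \<bar>u x\<bar>\<^sup>2 - 2 * (\<bar>w x\<bar> * \<bar>u x\<bar>)"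
          using that by (simp add: power2_diff field_simps power2_eq_square del: abs_mult_self_eq)
        finally have "2 * (\<bar>w x\<bar> * \<bar>u x\<bar>) \<le> \<kappa> * (w x)\<^sup>2 + 1 / \<kappa> * (u x)\<^sup>2"
          by simp
        moreover have "0 \<le> \<bar>w x\<bar> * \<bar>u x\<bar>"
          by simp
        ultimately show ?thesis
          unfolding abs_mult by linarith
      qed
    qed (use iwu w(2) u2 in auto)
    also have "\<dots> = \<kappa> * ?W + 1 / \<kappa> * integral\<^sup>L (P \<alpha>) (\<lambda>x. (u x)\<^sup>2)"
      using w(2) u2 by simp
    also have "\<dots> \<le> \<kappa> * ?W + 1 / \<kappa> * \<kappa>\<^sup>2"
      using app that by (intro add_left_mono mult_left_mono) (auto simp: u_def s_def)
    also have "\<dots> = \<kappa> * (?W + 1)"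
      using that by (simp add: power2_eq_square distrib_left)
    finally show ?thesis .
  qed
  have "?W + 1 > 0"
    by (intro add_nonneg_pos) auto
  have "\<bar>integral\<^sup>L (P \<alpha>) (\<lambda>x. w x * f x)\<bar> \<le> 0 + e" if "e > 0" for e
    using bound[of "e / (?W + 1)"] \<open>?W + 1 > 0\<close> that by simp
  then have "\<bar>integral\<^sup>L (P \<alpha>) (\<lambda>x. w x * f x)\<bar> \<le> 0"
    by (rule field_le_epsilon)
  then show ?thesis
    by simp
qed

text \<open>The constant 1 is square integrable and orthogonal to every score, hence to their closed
  span.\<close>

lemma tangent_space_mean_zero:
  assumes "\<And>\<beta>. prob_space (P \<beta>)" "f \<in> tangent_space P \<alpha>"
  shows "integral\<^sup>L (P \<alpha>) f = 0"
proof -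
  interpret prob_space "P \<alpha>"
    by (rule assms)
  have "integral\<^sup>L (P \<alpha>) (\<lambda>x. 1 * f x) = 0"
  proof (rule tangent_space_orthogonal[OF _ _ _ assms(2)])
    show "integral\<^sup>L (P \<alpha>) (\<lambda>x. 1 * g x) = 0" if "g \<in> scores P \<alpha>" for g
      using score_mean_zero[where P=P and \<alpha>=\<alpha> and g=g, OF assms(1) that] by simp
  qed simp_all
  then show ?thesis
    by simp
qed

text \<open>With r = h - \<phi>, the product r1 r2 equals h1 h2 - \<phi>1 \<phi>2 - r1 \<phi>2 - r2
  \<phi>1, and the last two terms integrate to 0 by orthogonality.\<close>

lemma tangent_residual_inner:
  fixes h1 h2 :: "'x \<Rightarrow> real"
  assumes h1: "h1 \<in> borel_measurable (P \<alpha>)" "integrable (P \<alpha>) (\<lambda>x. (h1 x)\<^sup>2)"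
    and h2: "h2 \<in> borel_measurable (P \<alpha>)" "integrable (P \<alpha>) (\<lambda>x. (h2 x)\<^sup>2)"
    and p1: "is_tangent_projection P \<alpha> h1 \<phi>1" and p2: "is_tangent_projection P \<alpha> h2 \<phi>2"
  shows "integral\<^sup>L (P \<alpha>) (\<lambda>x. (h1 x - \<phi>1 x) * (h2 x - \<phi>2 x)) =
    integral\<^sup>L (P \<alpha>) (\<lambda>x. h1 x * h2 x) - integral\<^sup>L (P \<alpha>) (\<lambda>x. \<phi>1 x * \<phi>2 x)"
proof -
  have \<phi>: "\<phi>1 \<in> tangent_space P \<alpha>" "\<phi>2 \<in> tangent_space P \<alpha>"
    using p1 p2 by (auto simp: is_tangent_projection_def)
  then have m: "\<phi>1 \<in> borel_measurable (P \<alpha>)" "integrable (P \<alpha>) (\<lambda>x. (\<phi>1 x)\<^sup>2)"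
    "\<phi>2 \<in> borel_measurable (P \<alpha>)" "integrable (P \<alpha>) (\<lambda>x. (\<phi>2 x)\<^sup>2)"
    by (auto simp: tangent_space_def)
  have r: "(\<lambda>x. h1 x - \<phi>1 x) \<in> borel_measurable (P \<alpha>)" "integrable (P \<alpha>) (\<lambda>x. (h1 x - \<phi>1 x)\<^sup>2)"
    "(\<lambda>x. h2 x - \<phi>2 x) \<in> borel_measurable (P \<alpha>)" "integrable (P \<alpha>) (\<lambda>x. (h2 x - \<phi>2 x)\<^sup>2)"
    using h1 h2 m square_integrable_add[of h1 "P \<alpha>" "\<lambda>x. - \<phi>1 x"]
      square_integrable_add[of h2 "P \<alpha>" "\<lambda>x. - \<phi>2 x"] by auto
  have o1: "integral\<^sup>L (P \<alpha>) (\<lambda>x. (h1 x - \<phi>1 x) * \<phi>2 x) = 0"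
    by (rule tangent_space_orthogonal[OF r(1,2) _ \<phi>(2)]) (use p1 in \<open>simp add: is_tangent_projection_def\<close>)
  have o2: "integral\<^sup>L (P \<alpha>) (\<lambda>x. (h2 x - \<phi>2 x) * \<phi>1 x) = 0"
    by (rule tangent_space_orthogonal[OF r(3,4) _ \<phi>(1)]) (use p2 in \<open>simp add: is_tangent_projection_def\<close>)
  have i: "integrable (P \<alpha>) (\<lambda>x. h1 x * h2 x)" "integrable (P \<alpha>) (\<lambda>x. \<phi>1 x * \<phi>2 x)"
    "integrable (P \<alpha>) (\<lambda>x. (h1 x - \<phi>1 x) * \<phi>2 x)" "integrable (P \<alpha>) (\<lambda>x. (h2 x - \<phi>2 x) * \<phi>1 x)"
    by (intro integrable_mult_square_integrable h1 h2 m r)+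
  have "integral\<^sup>L (P \<alpha>) (\<lambda>x. (h1 x - \<phi>1 x) * (h2 x - \<phi>2 x)) =
      integral\<^sup>L (P \<alpha>) (\<lambda>x. h1 x * h2 x - \<phi>1 x * \<phi>2 x - (h1 x - \<phi>1 x) * \<phi>2 x - (h2 x - \<phi>2 x) * \<phi>1 x)"
    by (intro Bochner_Integration.integral_cong) (auto simp: algebra_simps)
  also have "\<dots> = integral\<^sup>L (P \<alpha>) (\<lambda>x. h1 x * h2 x) - integral\<^sup>L (P \<alpha>) (\<lambda>x. \<phi>1 x * \<phi>2 x)"
    using i o1 o2 by (simp del: right_diff_distrib' left_diff_distrib')
  finally show ?thesis .
qed

section \<open>The score process with estimated parameter\<close>

text \<open>If all three scaled suprema are at most \<open>e / 3\<close>, then every coordinate of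
  \<open>y\<close> is at most \<open>e\<close> in absolute value; subadditivity of outer probability
  bounds the exceptional event.\<close>

lemma oP1_supn_sqrt_combination:
  assumes Q: "prob_space Q"
    and a: "oP1 Q (\<lambda>n \<omega>. ereal (sqrt (real n)) * supn (a n \<omega>))"
    and b: "oP1 Q (\<lambda>n \<omega>. ereal (sqrt (real n)) * supn (b n \<omega>))"
    and c: "oP1 Q (\<lambda>n \<omega>. ereal (sqrt (real n)) * supn (c n \<omega>))"
    and y: "\<And>n \<omega> \<gamma>. \<omega> \<in> space Q \<Longrightarrow> y n \<omega> \<gamma> = sqrt (real n) * (a n \<omega> \<gamma> - b n \<omega> \<gamma> - c n \<omega> \<gamma>)"
  shows "oP1 Q (\<lambda>n \<omega>. supn (y n \<omega>))"
  unfolding oP1_def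
proof (intro allI impI)
  fix e :: real
  assume "e > 0"
  then have e3: "e / 3 > 0"
    by simp
  define S where "S z n = {\<omega> \<in> space Q. ereal (sqrt (real n)) * supn (z n \<omega>) > ereal (e / 3)}"
    for z :: "nat \<Rightarrow> 'a \<Rightarrow> 'b \<Rightarrow> real" and n
  have lim: "(\<lambda>n. outer_prob Q (S a n) + outer_prob Q (S b n) + outer_prob Q (S c n)) \<longlonglongrightarrow> 0 + 0 + 0"
    using a b c e3 unfolding oP1_def S_def by (intro tendsto_add) blast+
  \<comment> \<open>\<open>supn\<close> may be infinite, so the comparison is made in
    \<open>ereal\<close> and only bounds for single indices are carried on.\<close>
  have small: "sqrt (real n) * \<bar>z n \<omega> \<gamma>\<bar> \<le> e / 3" if "\<omega> \<in> space Q" "\<omega> \<notin> S z n" for z n \<omega> \<gamma>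
  proof -
    have "ereal (sqrt (real n)) * ereal \<bar>z n \<omega> \<gamma>\<bar> \<le> ereal (sqrt (real n)) * supn (z n \<omega>)"
      unfolding supn_def by (intro ereal_mult_left_mono SUP_upper) auto
    also have "\<dots> \<le> ereal (e / 3)"
      using that by (simp add: S_def)
    finally show ?thesis
      by simp
  qed
  have "outer_prob Q {\<omega> \<in> space Q. supn (y n \<omega>) > ereal e}
      \<le> outer_prob Q (S a n) + outer_prob Q (S b n) + outer_prob Q (S c n)" for n
  proof -
    have "{\<omega> \<in> space Q. supn (y n \<omega>) > ereal e} \<subseteq> S a n \<union> S b n \<union> S c n"
    proof (rule subsetI, rule ccontr)
      fix \<omega>
      assume "\<omega> \<in> {\<omega> \<in> space Q. supn (y n \<omega>) > ereal e}" and nS: "\<omega> \<notin> S a n \<union> S b n \<union> S c n"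
      then have \<omega>: "\<omega> \<in> space Q" and gt: "supn (y n \<omega>) > ereal e"
        by auto
      have "\<bar>y n \<omega> \<gamma>\<bar> \<le> e" for \<gamma>
      proof -
        have "\<bar>y n \<omega> \<gamma>\<bar> = sqrt (real n) * \<bar>a n \<omega> \<gamma> - b n \<omega> \<gamma> - c n \<omega> \<gamma>\<bar>"
          using y[OF \<omega>] by (simp add: abs_mult)
        also have "\<dots> \<le> sqrt (real n) * (\<bar>a n \<omega> \<gamma>\<bar> + \<bar>b n \<omega> \<gamma>\<bar> + \<bar>c n \<omega> \<gamma>\<bar>)"
          by (rule mult_left_mono) (linarith, simp)
        also have "\<dots> \<le> e"
          using small[OF \<omega>, of a n \<gamma>] small[OF \<omega>, of b n \<gamma>] small[OF \<omega>, of c n \<gamma>] nS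
          by (simp add: distrib_left)
        finally show ?thesis .
      qed
      then have "supn (y n \<omega>) \<le> ereal e"
        by (simp add: supn_le_iff)
      then show False
        using gt by simp
    qed
    then have "outer_prob Q {\<omega> \<in> space Q. supn (y n \<omega>) > ereal e} \<le> outer_prob Q (S a n \<union> S b n \<union> S c n)"
      by (intro outer_prob_mono) auto
    then show ?thesis
      using outer_prob_Un[OF Q, of "S a n \<union> S b n" "S c n"] outer_prob_Un[OF Q, of "S a n" "S b n"]
      by linarith
  qed
  then have upper: "\<forall>\<^sub>F n in sequentially. outer_prob Q {\<omega> \<in> space Q. supn (y n \<omega>) > ereal e}
      \<le> outer_prob Q (S a n) + outer_prob Q (S b n) + outer_prob Q (S c n)"
    by simp
  show "(\<lambda>n. outer_prob Q {\<omega> \<in> space Q. supn (y n \<omega>) > ereal e}) \<longlonglongrightarrow> 0"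
  proof (rule tendsto_sandwich[OF _ upper tendsto_const])
    show "\<forall>\<^sub>F n in sequentially. 0 \<le> outer_prob Q {\<omega> \<in> space Q. supn (y n \<omega>) > ereal e}"
      by (simp add: outer_prob_nonneg)
  qed (use lim in simp)
qed

lemma Pn_diff: "Pn n \<omega> (\<lambda>x. f x - g x) = Pn n \<omega> f - Pn n \<omega> g"
  by (simp add: Pn_def sum_subtractf diff_divide_distrib)

text \<open>Valid also for \<open>n = 0\<close>, where division by zero makes both sides 0.\<close>

lemma sqrt_mult_Pn: "sqrt (real n) * Pn n \<omega> f = (\<Sum>i<n. f (\<omega> i)) / sqrt (real n)"
  by (cases "n = 0") (simp_all add: Pn_def field_simps)

theorem theorem3p1:
  fixes M :: "'x measure"
    and P :: "'a::metric_space \<Rightarrow> 'x measure"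
    and \<alpha>0 :: 'a
    and \<alpha>hat :: "nat \<Rightarrow> (nat \<Rightarrow> 'x) \<Rightarrow> 'a"
    and h :: "'g \<Rightarrow> 'a \<Rightarrow> 'x \<Rightarrow> real"
    and Pih :: "'g \<Rightarrow> 'x \<Rightarrow> real"
  defines "\<Omega> \<equiv> iid_space (P \<alpha>0)"
    and "Zn \<equiv> (\<lambda>n \<omega> \<gamma>. (\<Sum>i<n. h \<gamma> \<alpha>0 (\<omega> i) - Pih \<gamma> (\<omega> i)) / sqrt (real n))"
    and "Wn \<equiv> (\<lambda>n \<omega> \<gamma>. sqrt (real n) *
               (Pn n \<omega> (h \<gamma> (\<alpha>hat n \<omega>)) - integral\<^sup>L (P (\<alpha>hat n \<omega>)) (h \<gamma> (\<alpha>hat n \<omega>))))"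
    and "Cov \<equiv> (\<lambda>\<gamma>1 \<gamma>2.
               (integral\<^sup>L (P \<alpha>0) (\<lambda>x. h \<gamma>1 \<alpha>0 x * h \<gamma>2 \<alpha>0 x)
                 - integral\<^sup>L (P \<alpha>0) (h \<gamma>1 \<alpha>0) * integral\<^sup>L (P \<alpha>0) (h \<gamma>2 \<alpha>0))
             - (integral\<^sup>L (P \<alpha>0) (\<lambda>x. Pih \<gamma>1 x * Pih \<gamma>2 x)
                 - integral\<^sup>L (P \<alpha>0) (Pih \<gamma>1) * integral\<^sup>L (P \<alpha>0) (Pih \<gamma>2)))"
  assumes model: "\<forall>\<alpha>. prob_space (P \<alpha>) \<and> sets (P \<alpha>) = sets M"
    and estimator: "\<forall>n \<omega> \<omega>'. (\<forall>i<n. \<omega> i = \<omega>' i) \<longrightarrow> \<alpha>hat n \<omega> = \<alpha>hat n \<omega>'"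
    and h_L20: "\<forall>\<gamma> \<alpha>. h \<gamma> \<alpha> \<in> borel_measurable M \<and> integral\<^sup>L (P \<alpha>) (h \<gamma> \<alpha>) = 0"
    and h_bdd: "\<forall>\<alpha>. \<exists>B. \<forall>\<gamma>. \<forall>x\<in>space M. \<bar>h \<gamma> \<alpha> x\<bar> \<le> B"
    and proj: "\<forall>\<gamma>. is_tangent_projection P \<alpha>0 (h \<gamma> \<alpha>0) (Pih \<gamma>)"
    and M0: "universal_Donsker M (\<lambda>\<gamma> x. h \<gamma> \<alpha>0 x - Pih \<gamma> x)"
    and M3: "oP1 \<Omega> (\<lambda>n \<omega>. ereal (sqrt (real n)) * supn (\<lambda>\<gamma>.
               Pn n \<omega> (\<lambda>x. h \<gamma> (\<alpha>hat n \<omega>) x - h \<gamma> \<alpha>0 x)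
               - integral\<^sup>L (P \<alpha>0) (\<lambda>x. h \<gamma> (\<alpha>hat n \<omega>) x - h \<gamma> \<alpha>0 x)))"
    and M4: "oP1 \<Omega> (\<lambda>n \<omega>. ereal (sqrt (real n)) * supn (\<lambda>\<gamma>.
               integral\<^sup>L (P (\<alpha>hat n \<omega>)) (\<lambda>x. h \<gamma> (\<alpha>hat n \<omega>) x - h \<gamma> \<alpha>0 x)
               - integral\<^sup>L (P \<alpha>0) (\<lambda>x. h \<gamma> (\<alpha>hat n \<omega>) x - h \<gamma> \<alpha>0 x)))"
    and M5: "oP1 \<Omega> (\<lambda>n \<omega>. ereal (sqrt (real n)) * supn (\<lambda>\<gamma>.
               (integral\<^sup>L (P (\<alpha>hat n \<omega>)) (h \<gamma> \<alpha>0) - integral\<^sup>L (P \<alpha>0) (h \<gamma> \<alpha>0))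
               - (Pn n \<omega> (Pih \<gamma>) - integral\<^sup>L (P \<alpha>0) (Pih \<gamma>))))"
  shows "\<exists>L. tight_borel_law L \<and> centered_gaussian_law L Cov \<and>
           weak_conv_HJ \<Omega> Zn L \<and>
           oP1 \<Omega> (\<lambda>n \<omega>. supn (\<lambda>\<gamma>. Wn n \<omega> \<gamma> - Zn n \<omega> \<gamma>)) \<and>
           weak_conv_HJ \<Omega> Wn L"
proof -
  define f where "f \<gamma> x = h \<gamma> \<alpha>0 x - Pih \<gamma> x" for \<gamma> x
  have pP: "prob_space (P \<beta>)" and sP: "sets (P \<beta>) = sets M" for \<beta>
    using model by auto
  have spP: "space (P \<beta>) = space M" for \<beta>
    by (rule sets_eq_imp_space_eq[OF sP])
  have p\<Omega>: "prob_space \<Omega>"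
    unfolding \<Omega>_def using pP by (rule prob_space_iid_space)
  have \<Omega>M: "\<omega> i \<in> space M" if "\<omega> \<in> space \<Omega>" for \<omega> i
    using that spP[of \<alpha>0] by (auto simp: \<Omega>_def iid_space_def space_PiM PiE_iff)
  \<comment> \<open>The parameter of \<open>h\<close> and that of the law are independent: (M3) to
    (M5) integrate \<open>h\<close> at one parameter under the law of another.\<close>
  have hm: "h \<gamma> \<beta> \<in> borel_measurable (P \<beta>')" for \<gamma> \<beta> \<beta>'
    using h_L20 measurable_cong_sets[OF sP refl] by blast
  have h0: "integral\<^sup>L (P \<beta>) (h \<gamma> \<beta>) = 0" for \<gamma> \<beta>
    using h_L20 by simp
  have hi: "integrable (P \<beta>') (h \<gamma> \<beta>)" and h2: "integrable (P \<beta>') (\<lambda>x. (h \<gamma> \<beta> x)\<^sup>2)" for \<gamma> \<beta> \<beta>'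
  proof -
    interpret prob_space "P \<beta>'"
      by (rule pP)
    obtain B where B: "\<And>x. x \<in> space M \<Longrightarrow> \<bar>h \<gamma> \<beta> x\<bar> \<le> B"
      using h_bdd by blast
    show "integrable (P \<beta>') (h \<gamma> \<beta>)"
      using B hm by (intro integrable_const_bound[where B=B]) (auto simp: spP)
    have "AE x in P \<beta>'. norm ((h \<gamma> \<beta> x)\<^sup>2) \<le> B\<^sup>2"
      using B power_mono[OF _ abs_ge_zero, of _ B 2] by (intro AE_I2) (auto simp: spP)
    then show "integrable (P \<beta>') (\<lambda>x. (h \<gamma> \<beta> x)\<^sup>2)"
      using hm by (intro integrable_const_bound[where B="B\<^sup>2"]) auto
  qed
  have Pt: "Pih \<gamma> \<in> tangent_space P \<alpha>0" for \<gamma>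
    using proj by (simp add: is_tangent_projection_def)
  then have Pm: "Pih \<gamma> \<in> borel_measurable (P \<alpha>0)" and P2: "integrable (P \<alpha>0) (\<lambda>x. (Pih \<gamma> x)\<^sup>2)" for \<gamma>
    by (auto simp: tangent_space_def)
  have Pi: "integrable (P \<alpha>0) (Pih \<gamma>)" for \<gamma>
    by (rule finite_measure.square_integrable_imp_integrable[OF prob_space.finite_measure[OF pP] Pm P2])
  have P0: "integral\<^sup>L (P \<alpha>0) (Pih \<gamma>) = 0" for \<gamma>
    by (rule tangent_space_mean_zero[where P=P, OF pP Pt])
  have fm: "f \<gamma> \<in> borel_measurable (P \<alpha>0)" for \<gamma>
    unfolding f_def using hm Pm by (rule borel_measurable_diff)
  have f2: "integrable (P \<alpha>0) (\<lambda>x. (f \<gamma> x)\<^sup>2)" for \<gamma>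
    using square_integrable_add[of "h \<gamma> \<alpha>0" "P \<alpha>0" "\<lambda>x. - Pih \<gamma> x"] hm h2 Pm P2 by (simp add: f_def)
  have f0: "integral\<^sup>L (P \<alpha>0) (f \<gamma>) = 0" for \<gamma>
    unfolding f_def using hi Pi h0 P0 by simp
  have "Donsker (P \<alpha>0) f"
    using M0 pP sP unfolding universal_Donsker_def f_def by blast
  \<comment> \<open>As the residuals have mean zero, the empirical process in \<open>Donsker\<close>
    loses its centring and becomes the score process.\<close>
  then obtain L where L: "tight_borel_law L"
    and conv: "weak_conv_HJ \<Omega> (\<lambda>n \<omega> \<gamma>. sqrt (real n) * Pn n \<omega> (f \<gamma>)) L"
    and fb: "\<And>x. x \<in> space (P \<alpha>0) \<Longrightarrow> bounded (range (\<lambda>\<gamma>. f \<gamma> x))"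
    unfolding Donsker_def f0 diff_zero \<Omega>_def by blast
  have Zn: "Zn = (\<lambda>n \<omega> \<gamma>. (\<Sum>i<n. f \<gamma> (\<omega> i)) / sqrt (real n))"
    by (simp add: Zn_def f_def)
  have Zconv: "weak_conv_HJ \<Omega> Zn L"
    using conv unfolding Zn sqrt_mult_Pn .
  have "centered_gaussian_law L (\<lambda>\<gamma>1 \<gamma>2. integral\<^sup>L (P \<alpha>0) (\<lambda>x. f \<gamma>1 x * f \<gamma>2 x))"
    using pP fm f2 f0 L Zconv[unfolded Zn \<Omega>_def] by (rule centered_gaussian_lawI)
  moreover have "(\<lambda>\<gamma>1 \<gamma>2. integral\<^sup>L (P \<alpha>0) (\<lambda>x. f \<gamma>1 x * f \<gamma>2 x)) = Cov"
    unfolding Cov_def f_def h0 P0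
    using tangent_residual_inner[of "h _ \<alpha>0" P \<alpha>0 "h _ \<alpha>0" "Pih _" "Pih _", OF hm h2 hm h2] proj
    by (intro ext) simp
  ultimately have gauss: "centered_gaussian_law L Cov"
    by simp
  have WZ: "oP1 \<Omega> (\<lambda>n \<omega>. supn (\<lambda>\<gamma>. Wn n \<omega> \<gamma> - Zn n \<omega> \<gamma>))"
  proof (rule oP1_supn_sqrt_combination[OF p\<Omega> M3 M4 M5])
    fix n :: nat and \<omega> \<gamma>
    show "Wn n \<omega> \<gamma> - Zn n \<omega> \<gamma> = sqrt (real n) *
      ((Pn n \<omega> (\<lambda>x. h \<gamma> (\<alpha>hat n \<omega>) x - h \<gamma> \<alpha>0 x)
          - integral\<^sup>L (P \<alpha>0) (\<lambda>x. h \<gamma> (\<alpha>hat n \<omega>) x - h \<gamma> \<alpha>0 x))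
        - (integral\<^sup>L (P (\<alpha>hat n \<omega>)) (\<lambda>x. h \<gamma> (\<alpha>hat n \<omega>) x - h \<gamma> \<alpha>0 x)
          - integral\<^sup>L (P \<alpha>0) (\<lambda>x. h \<gamma> (\<alpha>hat n \<omega>) x - h \<gamma> \<alpha>0 x))
        - ((integral\<^sup>L (P (\<alpha>hat n \<omega>)) (h \<gamma> \<alpha>0) - integral\<^sup>L (P \<alpha>0) (h \<gamma> \<alpha>0))
          - (Pn n \<omega> (Pih \<gamma>) - integral\<^sup>L (P \<alpha>0) (Pih \<gamma>))))"
    proof -
      have Z: "Zn n \<omega> \<gamma> = sqrt (real n) * (Pn n \<omega> (h \<gamma> \<alpha>0) - Pn n \<omega> (Pih \<gamma>))"
        unfolding Zn f_def Pn_diff[symmetric] sqrt_mult_Pn ..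
      have I: "integral\<^sup>L (P \<beta>) (\<lambda>x. h \<gamma> (\<alpha>hat n \<omega>) x - h \<gamma> \<alpha>0 x) =
          integral\<^sup>L (P \<beta>) (h \<gamma> (\<alpha>hat n \<omega>)) - integral\<^sup>L (P \<beta>) (h \<gamma> \<alpha>0)" for \<beta>
        by (rule Bochner_Integration.integral_diff[OF hi hi])
      show ?thesis
        \<comment> \<open>(M3) minus (M4) minus (M5) telescopes to the difference of the two
          processes plus the \<open>P \<alpha>0\<close>-means of \<open>h \<gamma> \<alpha>0\<close>
          and, with opposite sign, \<open>Pih \<gamma>\<close>; both are 0.\<close>
        unfolding Wn_def Z I Pn_diff h0 P0 right_diff_distrib by linarith
    qed
  qed
  \<comment> \<open>\<open>Pih\<close> has no bound uniform in the index, so the pointwise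
    boundedness in \<open>Donsker\<close> is applied at each of the finitely many
    observations.\<close>
  have Zl: "Zn n \<omega> \<in> linf" if \<omega>: "\<omega> \<in> space \<Omega>" for n \<omega>
  proof -
    have "\<exists>b. \<forall>\<gamma>. \<bar>f \<gamma> (\<omega> i)\<bar> \<le> b" for i
      using fb[of "\<omega> i"] \<Omega>M[OF \<omega>] by (auto simp: spP bounded_iff)
    then obtain b where b: "\<And>i \<gamma>. \<bar>f \<gamma> (\<omega> i)\<bar> \<le> b i"
      by metis
    have "\<bar>Zn n \<omega> \<gamma>\<bar> \<le> (\<Sum>i<n. b i) / sqrt (real n)" for \<gamma>
    proof -
      have "\<bar>\<Sum>i<n. f \<gamma> (\<omega> i)\<bar> \<le> (\<Sum>i<n. b i)"
        using b by (intro order_trans[OF sum_abs] sum_mono)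
      then show ?thesis
        unfolding Zn abs_divide by (simp add: divide_right_mono)
    qed
    then show ?thesis
      by (rule linfI)
  qed
  \<comment> \<open>For fixed sample and \<open>n\<close> the estimate is one parameter, so
    \<open>h_bdd\<close> gives a bound for all indices, and the centring under the estimated law is
    0.\<close>
  have Wl: "Wn n \<omega> \<in> linf" if \<omega>: "\<omega> \<in> space \<Omega>" for n \<omega>
  proof -
    obtain B where B: "\<And>\<gamma> x. x \<in> space M \<Longrightarrow> \<bar>h \<gamma> (\<alpha>hat n \<omega>) x\<bar> \<le> B"
      using h_bdd by blast
    have "\<bar>Wn n \<omega> \<gamma>\<bar> \<le> (\<Sum>i<n. B) / sqrt (real n)" for \<gamma>
    proof -
      have "\<bar>\<Sum>i<n. h \<gamma> (\<alpha>hat n \<omega>) (\<omega> i)\<bar> \<le> (\<Sum>i<n. B)"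
        using B \<Omega>M[OF \<omega>] by (intro order_trans[OF sum_abs] sum_mono) auto
      then show ?thesis
        unfolding Wn_def h0 diff_zero sqrt_mult_Pn abs_divide by (simp add: divide_right_mono)
    qed
    then show ?thesis
      by (rule linfI)
  qed
  have "weak_conv_HJ \<Omega> Wn L"
    using weak_conv_HJ_Slutsky[OF p\<Omega> L Zconv Zl Wl WZ] .
  then show ?thesis
    using L gauss Zconv WZ by blast
qed

end
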